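(* Let $\lambda\in\mathbb{C}^*$, $a,b\in\mathbb{C}$, and let $W\in\mathcal{O}_{\mathfrak{W}}$ be a nontrivial simple $\mathfrak{W}$-module. (a) If $W$ is a highest weight module with highest weight $b'$, then the Virasoro module $\mathcal{L}(W,\lambda,a,b)$ is simple if and only if either $\lambda\ne1,-1$ and $b\ne1$; or $\lambda=-1$, $b\ne1$ and $b\ne b'+1$. (b) If $W$ is not a highest weight module, then $\mathcal{L}(W,\lambda,a,b)$ is simple if and only if $\lambda\ne1$ and $b\ne1$. (c) If $W$ is a highest weight module with highest weight $b'\ne0$ and highest weight vector $w_0$, then $\mathcal{L}_0(a,b')$ and $\mathcal{L}_1(a,b')$ are the only two nontrivial (i.e. nonzero and proper) submodules of $\mathcal{L}(W,-1,a,b'+1)$, and they are simple.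
   Context: $\mathbb{Z}_+$ denotes the nonnegative integers. The Virasoro algebra $\mathfrak{V}$ has basis $\{d_n,z : n\in\mathbb{Z}\}$, $z$ central, $[d_n,d_m]=(m-n)d_{m+n}+\delta_{n,-m}\frac{n^3-n}{12}z$. $\mathfrak{W}=\mathrm{Der}(\mathbb{C}[t])$ has basis $\{d_i=t^{i+1}\frac{d}{dt} : i\ge-1\}$ with $[d_n,d_m]=(m-n)d_{m+n}$. $\mathcal{O}_{\mathfrak{W}}$ is the category of all $\mathfrak{W}$-modules $W$ such that for every $w\in W$ there is a nonnegative integer $n$ (depending on $w$) with $d_iw=0$ for all $i\ge n$. A module $V$ over a Lie algebra $L$ is trivial if $LV=0$, nontrivial otherwise. A highest weight $\mathfrak{W}$-module with highest weight vector $w_0$ of highest weight $b'$ is a $\mathfrak{W}$-module generated by a nonzero vector $w_0$ with $d_0w_0=b'w_0$ and $d_iw_0=0$ for all $i>0$. For $W\in\mathcal{O}_{\mathfrak{W}}$, $\lambda\in\mathbb{C}^*$, $a,b\in\mathbb{C}$, $\mathcal{L}(W,\lambda,a,b)=W\otimes\mathbb{C}[t,t^{-1}]$ is the $\mathfrak{V}$-module with $z\cdot(w\otimes t^j)=0$ and $d_k\cdot(w\otimes t^j)=\big(((\lambda^ke^{kt}-1)\frac{d}{dt}+a+kb+j)w\big)\otimes t^{k+j}$ for $k,j\in\mathbb{Z}$, $w\in W$, where $\frac{d}{dt}$ acts as $d_{-1}$ and $e^{kt}\frac{d}{dt}$ acts as $\sum_{i\ge0}\frac{k^i}{i!}d_{i-1}$.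 For $W$ a highest weight module with highest weight vector $w_0$ of highest weight $b'\neq 0$, the following are submodules of $\mathcal{L}(W,-1,a,b'+1)$: $\mathcal{L}_0(a,b')=\mathrm{span}\{d_1^i\cdot(w_0\otimes t^{2j}) : i\in\mathbb{Z}_+,j\in\mathbb{Z}\}$ and $\mathcal{L}_1(a,b')=\mathrm{span}\{d_1^i\cdot(w_0\otimes t^{2j+1}) : i\in\mathbb{Z}_+,j\in\mathbb{Z}\}$. *)

theory Defs
  imports Complex_Main "HOL-Library.Poly_Mapping" "HOL-Library.Groups_Big_Fun"
    "HOL-Computational_Algebra.Polynomial"
begin

locale lie_algebra = vector_space scale
  for scale :: "'k::field \<Rightarrow> 'l::ab_group_add \<Rightarrow> 'l" +
  fixes bracket :: "'l \<Rightarrow> 'l \<Rightarrow> 'l"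
  assumes linear_bracket_left: "Vector_Spaces.linear scale scale (\<lambda>x. bracket x y)"
    and linear_bracket_right: "Vector_Spaces.linear scale scale (bracket x)"
    and bracket_self: "bracket x x = 0"
    and jacobi: "bracket x (bracket y z) + bracket y (bracket z x) + bracket z (bracket x y) = 0"

locale lie_module = L: lie_algebra scaleL bracket + V: vector_space scaleV
  for scaleL :: "'k::field \<Rightarrow> 'l::ab_group_add \<Rightarrow> 'l"
    and bracket :: "'l \<Rightarrow> 'l \<Rightarrow> 'l"
    and scaleV :: "'k \<Rightarrow> 'v::ab_group_add \<Rightarrow> 'v" +
  fixes act :: "'l \<Rightarrow> 'v \<Rightarrow> 'v"
  assumes linear_act_left: "Vector_Spaces.linear scaleL scaleV (\<lambda>x. act x v)"
    and linear_act_right: "Vector_Spaces.linear scaleV scaleV (act x)"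
    and act_bracket: "act (bracket x y) v = act x (act y v) - act y (act x v)"

definition lie_submodule ::
    "('k::field \<Rightarrow> 'v::ab_group_add \<Rightarrow> 'v) \<Rightarrow> ('l \<Rightarrow> 'v \<Rightarrow> 'v) \<Rightarrow> 'v set \<Rightarrow> bool" where
  "lie_submodule scaleV act N \<longleftrightarrow>
     module.subspace scaleV N \<and> (\<forall>x. \<forall>v\<in>N. act x v \<in> N)"

definition simple_lie_submodule ::
    "('k::field \<Rightarrow> 'v::ab_group_add \<Rightarrow> 'v) \<Rightarrow> ('l \<Rightarrow> 'v \<Rightarrow> 'v) \<Rightarrow> 'v set \<Rightarrow> bool" where
  "simple_lie_submodule scaleV act N \<longleftrightarrow>
     lie_submodule scaleV act N \<and> N \<noteq> {0} \<and>
     (\<forall>M. lie_submodule scaleV act M \<and> M \<subseteq> N \<longrightarrow> M = {0} \<or> M = N)"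

definition simple_lie_module ::
    "('k::field \<Rightarrow> 'l::ab_group_add \<Rightarrow> 'l) \<Rightarrow> ('l \<Rightarrow> 'l \<Rightarrow> 'l) \<Rightarrow>
     ('k \<Rightarrow> 'v::ab_group_add \<Rightarrow> 'v) \<Rightarrow> ('l \<Rightarrow> 'v \<Rightarrow> 'v) \<Rightarrow> bool" where
  "simple_lie_module scaleL bracket scaleV act \<longleftrightarrow>
     lie_module scaleL bracket scaleV act \<and> simple_lie_submodule scaleV act UNIV"

definition trivial_lie_module :: "('l \<Rightarrow> 'v::zero \<Rightarrow> 'v) \<Rightarrow> bool" where
  "trivial_lie_module act \<longleftrightarrow> (\<forall>x v. act x v = 0)"

text \<open>A derivation \<open>p d/dt\<close> of \<open>\<complex>[t]\<close> is represented by its coefficient \<open>p\<close>, and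
  \<open>witt_bracket\<close> is the commutator of derivations. The element \<open>witt_d i = t\<^sup>i\<^sup>+\<^sup>1 d/dt\<close> is
  meaningful for \<open>i \<ge> -1\<close> only.\<close>

definition witt_bracket :: "complex poly \<Rightarrow> complex poly \<Rightarrow> complex poly" where
  "witt_bracket p q = p * pderiv q - q * pderiv p"

definition witt_d :: "int \<Rightarrow> complex poly" where
  "witt_d i = monom 1 (nat (i + 1))"

abbreviation witt_module ::
    "(complex \<Rightarrow> 'w::ab_group_add \<Rightarrow> 'w) \<Rightarrow> (complex poly \<Rightarrow> 'w \<Rightarrow> 'w) \<Rightarrow> bool" where
  "witt_module \<equiv> lie_module smult witt_bracket"

abbreviation simple_witt_module ::
    "(complex \<Rightarrow> 'w::ab_group_add \<Rightarrow> 'w) \<Rightarrow> (complex poly \<Rightarrow> 'w \<Rightarrow> 'w) \<Rightarrow> bool" where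
  "simple_witt_module \<equiv> simple_lie_module smult witt_bracket"

definition in_O_witt ::
    "(complex \<Rightarrow> 'w::ab_group_add \<Rightarrow> 'w) \<Rightarrow> (complex poly \<Rightarrow> 'w \<Rightarrow> 'w) \<Rightarrow> bool" where
  "in_O_witt scale act \<longleftrightarrow>
     witt_module scale act \<and> (\<forall>w. \<exists>n::nat. \<forall>i\<ge>int n. act (witt_d i) w = 0)"

definition witt_highest_weight ::
    "(complex \<Rightarrow> 'w::ab_group_add \<Rightarrow> 'w) \<Rightarrow> (complex poly \<Rightarrow> 'w \<Rightarrow> 'w) \<Rightarrow>
     'w \<Rightarrow> complex \<Rightarrow> bool" where
  "witt_highest_weight scale act w0 b' \<longleftrightarrow>
     witt_module scale act \<and> w0 \<noteq> 0 \<and> lie_submodule scale act hull {w0} = UNIV \<and>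
     act (witt_d 0) w0 = scale b' w0 \<and> (\<forall>i>0. act (witt_d i) w0 = 0)"

datatype vir_basis = D int | Z

text \<open>The vector space with basis \<open>'i\<close> is \<open>'i \<Rightarrow>\<^sub>0 \<complex>\<close>; \<open>linear_ext s g\<close> is the linear map on it
  with value \<open>g p\<close> at the basis vector \<open>p\<close>.\<close>

definition pm_scale ::
    "('k \<Rightarrow> 'v::zero \<Rightarrow> 'v) \<Rightarrow> 'k \<Rightarrow> ('i \<Rightarrow>\<^sub>0 'v) \<Rightarrow> ('i \<Rightarrow>\<^sub>0 'v)" where
  "pm_scale s c = Poly_Mapping.map (s c)"

definition linear_ext ::
    "('k::zero \<Rightarrow> 'v::ab_group_add \<Rightarrow> 'v) \<Rightarrow> ('i \<Rightarrow> 'v) \<Rightarrow> ('i \<Rightarrow>\<^sub>0 'k) \<Rightarrow> 'v" where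
  "linear_ext s g x = (\<Sum>p\<in>Poly_Mapping.keys x. s (Poly_Mapping.lookup x p) (g p))"

abbreviation vir_scale :: "complex \<Rightarrow> (vir_basis \<Rightarrow>\<^sub>0 complex) \<Rightarrow> (vir_basis \<Rightarrow>\<^sub>0 complex)" where
  "vir_scale \<equiv> pm_scale (*)"

definition vir_d :: "int \<Rightarrow> (vir_basis \<Rightarrow>\<^sub>0 complex)" where
  "vir_d n = Poly_Mapping.single (D n) 1"

definition vir_z :: "vir_basis \<Rightarrow>\<^sub>0 complex" where
  "vir_z = Poly_Mapping.single Z 1"

fun vir_basis_bracket :: "vir_basis \<Rightarrow> vir_basis \<Rightarrow> (vir_basis \<Rightarrow>\<^sub>0 complex)" where
  "vir_basis_bracket (D n) (D m) =
     vir_scale (of_int (m - n)) (vir_d (m + n)) +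
     (if n = - m then vir_scale ((of_int n ^ 3 - of_int n) / 12) vir_z else 0)"
| "vir_basis_bracket _ _ = 0"

definition vir_bracket ::
    "(vir_basis \<Rightarrow>\<^sub>0 complex) \<Rightarrow> (vir_basis \<Rightarrow>\<^sub>0 complex) \<Rightarrow> (vir_basis \<Rightarrow>\<^sub>0 complex)" where
  "vir_bracket x y =
     linear_ext vir_scale (\<lambda>p. linear_ext vir_scale (vir_basis_bracket p) y) x"

text \<open>\<open>W \<otimes> \<complex>[t, t\<^sup>-\<^sup>1]\<close> is the type \<open>int \<Rightarrow>\<^sub>0 'w\<close> with scalar multiplication \<open>pm_scale scale\<close>;
  the tensor \<open>w \<otimes> t\<^sup>j\<close> is \<open>Poly_Mapping.single j w\<close>.

  \<open>witt_exp\<close> is the action of \<open>e\<^sup>k\<^sup>t d/dt\<close>. For modules in the category \<open>\<O>\<close>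
  the sum has finite support.\<close>

definition witt_exp ::
    "(complex \<Rightarrow> 'w::ab_group_add \<Rightarrow> 'w) \<Rightarrow> (complex poly \<Rightarrow> 'w \<Rightarrow> 'w) \<Rightarrow> int \<Rightarrow> 'w \<Rightarrow> 'w" where
  "witt_exp scale act k w =
     Sum_any (\<lambda>i::nat. scale (of_int k ^ i / fact i) (act (witt_d (int i - 1)) w))"

definition loop_coeff ::
    "(complex \<Rightarrow> 'w::ab_group_add \<Rightarrow> 'w) \<Rightarrow> (complex poly \<Rightarrow> 'w \<Rightarrow> 'w) \<Rightarrow>
     complex \<Rightarrow> complex \<Rightarrow> complex \<Rightarrow> int \<Rightarrow> int \<Rightarrow> 'w \<Rightarrow> 'w" where
  "loop_coeff scale act lam a b k j w =
     scale (lam powi k) (witt_exp scale act k w) - act (witt_d (-1)) w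
       + scale (a + of_int k * b + of_int j) w"

fun loop_basis_act ::
    "(complex \<Rightarrow> 'w::ab_group_add \<Rightarrow> 'w) \<Rightarrow> (complex poly \<Rightarrow> 'w \<Rightarrow> 'w) \<Rightarrow>
     complex \<Rightarrow> complex \<Rightarrow> complex \<Rightarrow> vir_basis \<Rightarrow> (int \<Rightarrow>\<^sub>0 'w) \<Rightarrow> (int \<Rightarrow>\<^sub>0 'w)" where
  "loop_basis_act scale act lam a b (D k) f =
     (\<Sum>j\<in>Poly_Mapping.keys f.
        Poly_Mapping.single (k + j) (loop_coeff scale act lam a b k j (Poly_Mapping.lookup f j)))"
| "loop_basis_act scale act lam a b Z f = 0"

definition loop_act ::
    "(complex \<Rightarrow> 'w::ab_group_add \<Rightarrow> 'w) \<Rightarrow> (complex poly \<Rightarrow> 'w \<Rightarrow> 'w) \<Rightarrow>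
     complex \<Rightarrow> complex \<Rightarrow> complex \<Rightarrow> (vir_basis \<Rightarrow>\<^sub>0 complex) \<Rightarrow> (int \<Rightarrow>\<^sub>0 'w) \<Rightarrow> (int \<Rightarrow>\<^sub>0 'w)" where
  "loop_act scale act lam a b x f =
     linear_ext (pm_scale scale) (\<lambda>p. loop_basis_act scale act lam a b p f) x"

definition loop_simple ::
    "(complex \<Rightarrow> 'w::ab_group_add \<Rightarrow> 'w) \<Rightarrow> (complex poly \<Rightarrow> 'w \<Rightarrow> 'w) \<Rightarrow>
     complex \<Rightarrow> complex \<Rightarrow> complex \<Rightarrow> bool" where
  "loop_simple scale act lam a b \<longleftrightarrow>
     simple_lie_module vir_scale vir_bracket (pm_scale scale) (loop_act scale act lam a b)"

text \<open>The submodules \<open>\<L>\<^sub>0\<close> and \<open>\<L>\<^sub>1\<close> of \<open>\<L>(W, -1, a, b' + 1)\<close> are the cases \<open>r = 0\<close> and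
  \<open>r = 1\<close>.\<close>

definition loop_half ::
    "(complex \<Rightarrow> 'w::ab_group_add \<Rightarrow> 'w) \<Rightarrow> (complex poly \<Rightarrow> 'w \<Rightarrow> 'w) \<Rightarrow>
     'w \<Rightarrow> int \<Rightarrow> complex \<Rightarrow> complex \<Rightarrow> (int \<Rightarrow>\<^sub>0 'w) set" where
  "loop_half scale act w0 r a b' =
     module.span (pm_scale scale)
       {(loop_act scale act (-1) a (b' + 1) (vir_d 1) ^^ i) (Poly_Mapping.single (2 * j + r) w0)
        | (i::nat) (j::int). True}"

lemma linearI:
  assumes "vector_space s1" "vector_space s2"
    and "\<And>x y. f (x + y) = f x + f y" "\<And>c x. f (s1 c x) = s2 c (f x)"
  shows "Vector_Spaces.linear s1 s2 f"
  using assms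
  by (auto intro!: Vector_Spaces.linear.intro module_hom.intro module_hom_axioms.intro
      simp: module_iff_vector_space)

lemma linear_add: "Vector_Spaces.linear s1 s2 f \<Longrightarrow> f (x + y) = f x + f y"
  and linear_scale: "Vector_Spaces.linear s1 s2 f \<Longrightarrow> f (s1 c x) = s2 c (f x)"
  and linear_zero: "Vector_Spaces.linear s1 s2 f \<Longrightarrow> f 0 = 0"
  and linear_diff: "Vector_Spaces.linear s1 s2 f \<Longrightarrow> f (x - y) = f x - f y"
  and linear_sum: "Vector_Spaces.linear s1 s2 f \<Longrightarrow> f (\<Sum>i\<in>A. h i) = (\<Sum>i\<in>A. f (h i))"
  by (simp_all add: module_hom.add module_hom.scale module_hom.zero module_hom.diff
      module_hom.sum flip: module_hom_iff_linear)

lemma witt_lie_algebra: "lie_algebra smult witt_bracket"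
proof -
  interpret vector_space "smult :: complex \<Rightarrow> complex poly \<Rightarrow> complex poly"
    by (rule Vector_Spaces.vector_space.intro) (simp_all add: smult_add_right smult_add_left)
  note vs = vector_space_axioms
  show ?thesis
  proof (rule lie_algebra.intro[OF vs], rule lie_algebra_axioms.intro)
    fix x y z :: "complex poly"
    show "Vector_Spaces.linear smult smult (\<lambda>x. witt_bracket x y)"
      by (rule linearI[OF vs vs])
        (simp_all add: witt_bracket_def pderiv_add pderiv_smult algebra_simps smult_diff_right)
    show "Vector_Spaces.linear smult smult (witt_bracket x)"
      by (rule linearI[OF vs vs])
        (simp_all add: witt_bracket_def pderiv_add pderiv_smult algebra_simps smult_diff_right)
    show "witt_bracket x x = 0"
      by (simp add: witt_bracket_def)
    show "witt_bracket x (witt_bracket y z) + witt_bracket y (witt_bracket z x)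
        + witt_bracket z (witt_bracket x y) = 0"
      by (simp add: witt_bracket_def pderiv_diff pderiv_mult algebra_simps)
  qed
qed

lemma witt_bracket_d:
  assumes "n \<ge> -1" "m \<ge> -1"
  shows "witt_bracket (witt_d n) (witt_d m) = smult (of_int (m - n)) (witt_d (m + n))"
proof -
  define i j where "i = nat (n + 1)" and "j = nat (m + 1)"
  have n: "n = int i - 1" and m: "m = int j - 1"
    using assms by (auto simp: i_def j_def)
  show ?thesis
  proof (cases "i = 0 \<and> j = 0")
    case False
    then have "nat (int i + int j - 1) = i + j - 1" by auto
    moreover have "i + (j - 1) = i + j - 1" if "j \<noteq> 0" using that by auto
    moreover have "j + (i - 1) = i + j - 1" if "i \<noteq> 0" using that by auto
    ultimately show ?thesis
      by (cases "i = 0"; cases "j = 0")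
        (auto simp: n m witt_bracket_def witt_d_def pderiv_monom mult_monom smult_monom
          diff_monom minus_monom algebra_simps)
  qed (simp add: n m witt_bracket_def witt_d_def pderiv_monom)
qed

lemma lookup_pm_scale:
  assumes "s c 0 = 0"
  shows "Poly_Mapping.lookup (pm_scale s c f) i = s c (Poly_Mapping.lookup f i)"
  using assms by (simp add: pm_scale_def map.rep_eq when_def)

lemma pm_scale_single:
  assumes "s c 0 = 0"
  shows "pm_scale s c (Poly_Mapping.single i v) = Poly_Mapping.single i (s c v)"
  by (rule poly_mapping_eqI) (simp add: lookup_pm_scale[where s = s, OF assms] lookup_single when_def assms)

lemma vector_space_pm_scale:
  assumes "vector_space s"
  shows "vector_space (pm_scale s)"
proof -
  interpret vector_space s by fact
  note l = lookup_pm_scale[where s = s, OF scale_zero_right]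
  show ?thesis
    by (rule Vector_Spaces.vector_space.intro)
      (auto intro!: poly_mapping_eqI
        simp: l lookup_add scale_right_distrib scale_left_distrib)
qed

lemma vector_space_mult: "vector_space ((*) :: 'k::field \<Rightarrow> 'k \<Rightarrow> 'k)"
  by (rule Vector_Spaces.vector_space.intro) (simp_all add: algebra_simps)

lemma pm_induct [case_names zero add single]:
  fixes x :: "'i \<Rightarrow>\<^sub>0 'b::comm_monoid_add"
  assumes "P 0" "\<And>x y. P x \<Longrightarrow> P y \<Longrightarrow> P (x + y)" "\<And>p c. P (Poly_Mapping.single p c)"
  shows "P x"
proof -
  have "P (\<Sum>p\<in>A. Poly_Mapping.single p (Poly_Mapping.lookup x p))" if "finite A" for A
    using that by (induction A) (auto intro: assms)
  moreover have "(\<Sum>p\<in>Poly_Mapping.keys x. Poly_Mapping.single p (Poly_Mapping.lookup x p)) = x"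
    by (rule poly_mapping_eqI) (auto simp: lookup_sum lookup_single when_def in_keys_iff)
  ultimately show ?thesis
    by (metis finite_keys)
qed

lemma linear_ext_superset:
  assumes "vector_space s" "finite A" "Poly_Mapping.keys x \<subseteq> A"
  shows "linear_ext s g x = (\<Sum>p\<in>A. s (Poly_Mapping.lookup x p) (g p))"
proof -
  interpret vector_space s by fact
  show ?thesis
    unfolding linear_ext_def
    by (rule sum.mono_neutral_left) (use assms in \<open>auto simp: in_keys_iff\<close>)
qed

lemma linear_linear_ext:
  fixes s :: "'b::field \<Rightarrow> 'c::ab_group_add \<Rightarrow> 'c" and g :: "'a \<Rightarrow> 'c"
  assumes "vector_space s"
  shows "Vector_Spaces.linear (pm_scale (*)) s (linear_ext s g)"
proof (rule linearI[OF vector_space_pm_scale[OF vector_space_mult] assms])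
  interpret vector_space s by fact
  fix x y :: "'a \<Rightarrow>\<^sub>0 'b" and c
  let ?A = "Poly_Mapping.keys x \<union> Poly_Mapping.keys y"
  have "Poly_Mapping.keys (x + y) \<subseteq> ?A" by (rule Poly_Mapping.keys_add)
  then show "linear_ext s g (x + y) = linear_ext s g x + linear_ext s g y"
    by (simp add: linear_ext_superset[OF assms, of ?A] lookup_add scale_left_distrib sum.distrib)
  have "Poly_Mapping.keys (pm_scale (*) c x) \<subseteq> Poly_Mapping.keys x"
    by (auto simp: in_keys_iff lookup_pm_scale)
  then show "linear_ext s g (pm_scale (*) c x) = s c (linear_ext s g x)"
    by (simp add: linear_ext_superset[OF assms, of "Poly_Mapping.keys x"] lookup_pm_scale
        scale_sum_right)
qed

lemma linear_ext_single:
  assumes "vector_space s"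
  shows "linear_ext s g (Poly_Mapping.single p c) = s c (g p)"
proof -
  interpret vector_space s by fact
  show ?thesis by (simp add: linear_ext_def)
qed

lemma linear_linear_ext_right:
  assumes "vector_space s" "\<And>p. Vector_Spaces.linear s' s (\<lambda>y. g p y)"
  shows "Vector_Spaces.linear s' s (\<lambda>y. linear_ext s (\<lambda>p. g p y) x)"
proof (rule linearI)
  interpret vector_space s by fact
  show "vector_space s'" using assms(2) by (simp add: Vector_Spaces.linear_def)
  show "vector_space s" by fact
  fix y z c
  show "linear_ext s (\<lambda>p. g p (y + z)) x = linear_ext s (\<lambda>p. g p y) x + linear_ext s (\<lambda>p. g p z) x"
    by (simp add: linear_ext_def linear_add[OF assms(2)] scale_right_distrib sum.distrib)
  show "linear_ext s (\<lambda>p. g p (s' c y)) x = s c (linear_ext s (\<lambda>p. g p y) x)"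
    by (simp add: linear_ext_def linear_scale[OF assms(2)] scale_sum_right mult.commute)
qed

lemma vector_space_vir: "vector_space vir_scale"
  by (rule vector_space_pm_scale[OF vector_space_mult])

lemma linear_vir_bracket_right: "Vector_Spaces.linear vir_scale vir_scale (vir_bracket x)"
  unfolding vir_bracket_def
  by (intro linear_linear_ext_right linear_linear_ext vector_space_vir)

lemma linear_vir_bracket_left: "Vector_Spaces.linear vir_scale vir_scale (\<lambda>x. vir_bracket x y)"
  unfolding vir_bracket_def by (intro linear_linear_ext vector_space_vir)

lemma vir_scale_single:
  "vir_scale c (Poly_Mapping.single p d) = Poly_Mapping.single p (c * d)"
  by (simp add: pm_scale_single)

lemma vir_bracket_single:
  "vir_bracket (Poly_Mapping.single p c) (Poly_Mapping.single q d) =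
     vir_scale (c * d) (vir_basis_bracket p q)"
proof -
  interpret vector_space vir_scale by (rule vector_space_vir)
  show ?thesis by (simp add: vir_bracket_def linear_ext_single[OF vector_space_vir])
qed

lemma vir_bracket_d_d:
  "vir_bracket (vir_d n) (vir_d m) =
     vir_scale (of_int (m - n)) (vir_d (m + n)) +
     (if n = - m then vir_scale ((of_int n ^ 3 - of_int n) / 12) vir_z else 0)"
  and vir_bracket_z: "vir_bracket vir_z x = 0" "vir_bracket x vir_z = 0"
proof -
  interpret vector_space vir_scale by (rule vector_space_vir)
  show "vir_bracket (vir_d n) (vir_d m) =
     vir_scale (of_int (m - n)) (vir_d (m + n)) +
     (if n = - m then vir_scale ((of_int n ^ 3 - of_int n) / 12) vir_z else 0)"
    by (simp add: vir_d_def[of n] vir_d_def[of m] vir_bracket_single)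
  show "vir_bracket vir_z x = 0"
    by (simp add: vir_bracket_def vir_z_def linear_ext_single[OF vector_space_vir])
      (simp add: linear_ext_def)
  have "vir_basis_bracket p Z = 0" for p by (cases p) simp_all
  then show "vir_bracket x vir_z = 0"
    by (simp add: vir_bracket_def vir_z_def linear_ext_single[OF vector_space_vir])
      (simp add: linear_ext_def)
qed

lemma vir_lie_algebra: "lie_algebra vir_scale vir_bracket"
proof (rule lie_algebra.intro[OF vector_space_vir], rule lie_algebra_axioms.intro)
  interpret vector_space vir_scale by (rule vector_space_vir)
  note R = linear_vir_bracket_right and L = linear_vir_bracket_left
  note lin = linear_add[OF R] linear_add[OF L] linear_scale[OF R] linear_scale[OF L]
    linear_zero[OF R] linear_zero[OF L]
  note sg = vir_scale_single[of _ _ 1, simplified, symmetric]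
  fix x y z :: "vir_basis \<Rightarrow>\<^sub>0 complex"
  show "Vector_Spaces.linear vir_scale vir_scale (\<lambda>x. vir_bracket x y)" by (rule L)
  show "Vector_Spaces.linear vir_scale vir_scale (vir_bracket x)" by (rule R)
  have skew_basis: "vir_basis_bracket p q = - vir_basis_bracket q p" for p q
  proof (cases p; cases q)
    fix n m assume "p = D n" "q = D m"
    then show ?thesis
      by (auto intro!: poly_mapping_eqI
          simp: lookup_pm_scale lookup_add vir_d_def vir_z_def lookup_single when_def
            divide_simps add.commute[of n m])
  qed auto
  have skew: "vir_bracket x y = - vir_bracket y x" for x y
  proof (induction x rule: pm_induct)
    case (single p c)
    show ?case
    proof (induction y rule: pm_induct)
      case (single q d)
      then show ?case
        using skew_basis[of p q] by (simp add: vir_bracket_single mult.commute)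
    qed (simp_all add: lin)
  qed (simp_all add: lin)
  show "vir_bracket x x = 0"
  proof -
    have "vir_scale 2 (vir_bracket x x) = 0"
      using skew[of x x] scale_left_distrib[of 1 1 "vir_bracket x x"]
      by (simp add: eq_neg_iff_add_eq_0)
    then show ?thesis by simp
  qed
  define J where "J x y z = vir_bracket x (vir_bracket y z) + vir_bracket y (vir_bracket z x)
        + vir_bracket z (vir_bracket x y)" for x y z
  define h :: "int \<Rightarrow> int \<Rightarrow> complex"
    where "h n m = (if n = - m then (of_int n ^ 3 - of_int n) / 12 else 0)" for n m
  have dd: "vir_bracket (vir_d n) (vir_d m) =
      vir_scale (of_int (m - n)) (vir_d (m + n)) + vir_scale (h n m) vir_z" for n m
    by (simp add: vir_bracket_d_d h_def)
  have JD: "J (vir_d n) (vir_d m) (vir_d l) = 0" for n m l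
  proof -
    have "J (vir_d n) (vir_d m) (vir_d l) =
        vir_scale (of_int ((l - m) * (m + l - n) + (n - l) * (l + n - m) + (m - n) * (n + m - l)))
          (vir_d (n + m + l))
        + vir_scale (of_int (l - m) * h n (m + l) + of_int (n - l) * h m (l + n)
            + of_int (m - n) * h l (n + m)) vir_z"
      by (simp add: J_def dd lin linear_diff[OF R] linear_diff[OF L] vir_bracket_z scale_left_distrib scale_right_distrib
          scale_left_diff_distrib algebra_simps)
    moreover have "(l - m) * (m + l - n) + (n - l) * (l + n - m) + (m - n) * (n + m - l) = 0"
      by (simp add: algebra_simps)
    moreover have "of_int (l - m) * h n (m + l) + of_int (n - l) * h m (l + n)
            + of_int (m - n) * h l (n + m) = 0"
    proof (cases "n + m + l = 0")
      case True
      then have l: "l = - n - m" by simp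
      show ?thesis by (simp add: h_def l field_simps power3_eq_cube)
    qed (auto simp: h_def)
    ultimately show ?thesis by simp
  qed
  have J1: "J (Poly_Mapping.single p 1) (Poly_Mapping.single q 1) (Poly_Mapping.single r 1) = 0"
    for p q r
  proof (cases p; cases q; cases r)
    fix n m l assume "p = D n" "q = D m" "r = D l"
    then show ?thesis using JD[of n m l] by (simp add: vir_d_def)
  qed (auto simp: J_def vir_bracket_z lin simp flip: vir_z_def)
  have J_add: "J (x + x') y z = J x y z + J x' y z" "J x (y + y') z = J x y z + J x y' z"
     "J x y (z + z') = J x y z + J x y z'"
    "J (vir_scale c x) y z = vir_scale c (J x y z)" "J x (vir_scale c y) z = vir_scale c (J x y z)"
     "J x y (vir_scale c z) = vir_scale c (J x y z)"
     "J 0 y z = 0" "J x 0 z = 0" "J x y 0 = 0" for c x y z x' y' z'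
    by (simp_all add: J_def lin scale_right_distrib algebra_simps)
  have "J x y z = 0"
  proof (induction x rule: pm_induct)
    case (single p c)
    show ?case
    proof (induction y rule: pm_induct)
      case (single q d)
      show ?case
      proof (induction z rule: pm_induct)
        case (single r e)
        show ?case
          by (simp add: sg[of p c] sg[of q d] sg[of r e] J_add J1)
      qed (simp_all add: J_add)
    qed (simp_all add: J_add)
  qed (simp_all add: J_add)
  then show "vir_bracket x (vir_bracket y z) + vir_bracket y (vir_bracket z x)
        + vir_bracket z (vir_bracket x y) = 0"
    by (simp add: J_def)
qed

context
  fixes scale :: "complex \<Rightarrow> 'w::ab_group_add \<Rightarrow> 'w" and act :: "complex poly \<Rightarrow> 'w \<Rightarrow> 'w"
  assumes O: "in_O_witt scale act"
begin

interpretation W: lie_module smult witt_bracket scale act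
  using O by (simp add: in_O_witt_def)

private abbreviation e :: "nat \<Rightarrow> 'w \<Rightarrow> 'w" where
  "e i \<equiv> act (witt_d (int i - 1))"

private lemma e_bracket:
  "e i (e j w) - e j (e i w) = scale (of_int (int j - int i)) (e (i + j - 1) w)"
proof -
  have *: "witt_bracket (witt_d (int i - 1)) (witt_d (int j - 1)) =
      smult (of_int (int j - int i)) (witt_d (int i + int j - 2))"
    by (subst witt_bracket_d) (simp_all add: algebra_simps)
  have "e i (e j w) - e j (e i w) = act (witt_bracket (witt_d (int i - 1)) (witt_d (int j - 1))) w"
    by (simp add: W.act_bracket)
  also have "\<dots> = scale (of_int (int j - int i)) (act (witt_d (int i + int j - 2)) w)"
    by (simp only: * linear_scale[OF W.linear_act_left])
  also have "\<dots> = scale (of_int (int j - int i)) (e (i + j - 1) w)"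
    by (cases "i = 0 \<and> j = 0") (auto simp: of_nat_diff algebra_simps)
  finally show ?thesis .
qed

private lemma e_bound: "\<exists>M. \<forall>i\<ge>M. e i w = 0"
proof -
  obtain n :: nat where n: "\<And>i. i \<ge> int n \<Longrightarrow> act (witt_d i) w = 0"
    using O by (force simp: in_O_witt_def)
  show ?thesis by (rule exI[of _ "n + 1"]) (auto intro: n)
qed

lemma witt_exp_eq:
  assumes "\<And>i. i \<ge> M \<Longrightarrow> act (witt_d (int i - 1)) w = 0"
  shows "witt_exp scale act k w =
    (\<Sum>i<M. scale (of_int k ^ i / fact i) (act (witt_d (int i - 1)) w))"
  unfolding witt_exp_def
  by (rule Sum_any.expand_superset) (use assms in \<open>auto simp: not_less[symmetric]\<close>)

lemma linear_witt_exp: "Vector_Spaces.linear scale scale (witt_exp scale act k)"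
proof (rule linearI[OF W.V.vector_space_axioms W.V.vector_space_axioms])
  note lin = linear_add[OF W.linear_act_right] linear_scale[OF W.linear_act_right]
  fix x y c
  obtain M1 M2 where "\<forall>i\<ge>M1. e i x = 0" "\<forall>i\<ge>M2. e i y = 0"
    using e_bound by blast
  moreover define M where "M = max M1 M2"
  ultimately have M: "\<And>i. i \<ge> M \<Longrightarrow> e i x = 0" "\<And>i. i \<ge> M \<Longrightarrow> e i y = 0"
    by auto
  show "witt_exp scale act k (x + y) = witt_exp scale act k x + witt_exp scale act k y"
    by (simp add: witt_exp_eq[of M] M lin sum.distrib W.V.scale_right_distrib)
  show "witt_exp scale act k (scale c x) = scale c (witt_exp scale act k x)"
    by (simp add: witt_exp_eq[of M] M lin W.V.scale_sum_right mult.commute)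
qed

lemma witt_exp_commute:
  "witt_exp scale act n (witt_exp scale act m w) - witt_exp scale act m (witt_exp scale act n w) =
     scale (of_int (m - n)) (witt_exp scale act (n + m) w)"
proof -
  note L = W.linear_act_right
  obtain M0 where M0: "\<And>i. i \<ge> M0 \<Longrightarrow> e i w = 0" using e_bound by blast
  have "\<forall>j. \<exists>N. \<forall>i\<ge>N. e i (e j w) = 0" using e_bound by blast
  from choice[OF this] obtain B where B: "\<And>j i. i \<ge> B j \<Longrightarrow> e i (e j w) = 0" by blast
  define M where "M = Suc M0 + (\<Sum>j<M0. B j)"
  have M: "e i w = 0" if "i \<ge> M" for i using that by (auto simp: M_def intro: M0)
  have M': "e (i + M - 1) w = 0" for i by (rule M0) (simp add: M_def)
  have MM: "e i (e j w) = 0" if "i \<ge> M" for i j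
  proof (cases "j < M0")
    case True
    then have "B j \<le> (\<Sum>j<M0. B j)" by (intro member_le_sum) auto
    then show ?thesis using that by (intro B) (auto simp: M_def)
  next
    case False
    then show ?thesis using M0[of j] by (simp add: linear_zero[OF L])
  qed
  define c :: "int \<Rightarrow> nat \<Rightarrow> complex" where "c k i = of_int k ^ i / fact i" for k i
  have E: "witt_exp scale act k w = (\<Sum>i<M. scale (c k i) (e i w))" for k
    unfolding c_def by (rule witt_exp_eq) (rule M)
  have EE: "witt_exp scale act k (witt_exp scale act l w) =
      (\<Sum>i<M. \<Sum>j<M. scale (c k i * c l j) (e i (e j w)))" for k l
  proof -
    have *: "e i (witt_exp scale act l w) = (\<Sum>j<M. scale (c l j) (e i (e j w)))" for i
      by (simp add: E linear_sum[OF L] linear_scale[OF L])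
    have "witt_exp scale act k (witt_exp scale act l w) =
        (\<Sum>i<M. scale (c k i) (e i (witt_exp scale act l w)))"
      unfolding c_def by (rule witt_exp_eq) (simp add: * MM)
    then show ?thesis by (simp add: * W.V.scale_sum_right)
  qed
  have half: "(\<Sum>i<M. \<Sum>j<M. scale (of_nat j * (c k i * c l j)) (e (i + j - 1) w)) =
      scale (of_int l) (witt_exp scale act (k + l) w)" for k l
  proof -
    have cS: "of_nat (Suc j) * c l (Suc j) = of_int l * c l j" for j
      unfolding c_def by (simp add: field_simps del: of_nat_Suc)
    have inner: "(\<Sum>j<M. scale (of_nat j * (c k i * c l j)) (e (i + j - 1) w)) =
       (\<Sum>j<M. scale (of_int l * (c k i * c l j)) (e (i + j) w))" for i
    proof -
      have "(\<Sum>j<M. scale (of_nat j * (c k i * c l j)) (e (i + j - 1) w)) =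
         (\<Sum>j<Suc M. scale (of_nat j * (c k i * c l j)) (e (i + j - 1) w))"
        using M'[of i] by simp
      also have "\<dots> = (\<Sum>j<M. scale (of_nat (Suc j) * (c k i * c l (Suc j))) (e (i + j) w))"
        by (subst sum.lessThan_Suc_shift) simp
      also have "\<dots> = (\<Sum>j<M. scale (of_int l * (c k i * c l j)) (e (i + j) w))"
        by (rule sum.cong[OF refl], rule arg_cong[where f = "\<lambda>u. scale u _"])
          (use cS in \<open>simp add: mult.left_commute del: of_nat_Suc\<close>)
      finally show ?thesis .
    qed
    have cc: "c (k + l) s = (\<Sum>i\<le>s. c k i * c l (s - i))" for s
    proof -
      have "c (k + l) s = (\<Sum>i\<le>s. of_nat (s choose i) * of_int k ^ i * of_int l ^ (s - i)) / fact s"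
        by (simp add: c_def binomial_ring)
      also have "\<dots> = (\<Sum>i\<le>s. c k i * c l (s - i))"
        unfolding sum_divide_distrib
        by (rule sum.cong) (auto simp: c_def binomial_fact field_simps)
      finally show ?thesis .
    qed
    have T: "e (i + j) w \<noteq> 0 \<Longrightarrow> i + j < M" for i j
      using M[of "i + j"] not_less by blast
    have "(\<Sum>i<M. \<Sum>j<M. scale (c k i * c l j) (e (i + j) w)) =
        (\<Sum>(i,j)\<in>{..<M} \<times> {..<M}. scale (c k i * c l j) (e (i + j) w))"
      by (simp add: sum.cartesian_product)
    also have "\<dots> = (\<Sum>(i,j)\<in>{(i,j). i + j < M}. scale (c k i * c l j) (e (i + j) w))"
      by (rule sum.mono_neutral_right) (auto dest: T simp del: of_nat_add)
    also have "\<dots> = (\<Sum>s<M. \<Sum>i\<le>s. scale (c k i * c l (s - i)) (e (i + (s - i)) w))"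
      by (rule sum.triangle_reindex)
    also have "\<dots> = (\<Sum>s<M. scale (c (k + l) s) (e s w))"
      by (rule sum.cong) (simp_all add: cc W.V.scale_sum_left)
    finally have fin: "(\<Sum>i<M. \<Sum>j<M. scale (c k i * c l j) (e (i + j) w)) =
        witt_exp scale act (k + l) w"
      by (simp only: E)
    have "(\<Sum>i<M. \<Sum>j<M. scale (of_int l * (c k i * c l j)) (e (i + j) w)) =
        scale (of_int l) (\<Sum>i<M. \<Sum>j<M. scale (c k i * c l j) (e (i + j) w))"
      by (simp only: W.V.scale_sum_right W.V.scale_scale)
    then show ?thesis
      by (simp only: inner fin)
  qed
  have "witt_exp scale act n (witt_exp scale act m w) - witt_exp scale act m (witt_exp scale act n w)
      = (\<Sum>i<M. \<Sum>j<M. scale (c n i * c m j) (e i (e j w)))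
        - (\<Sum>i<M. \<Sum>j<M. scale (c m j * c n i) (e j (e i w)))"
    unfolding EE by (subst (2) sum.swap) simp
  also have "\<dots> = (\<Sum>i<M. \<Sum>j<M. scale (c n i * c m j) (e i (e j w) - e j (e i w)))"
    by (simp add: W.V.scale_right_diff_distrib sum_subtractf mult.commute)
  also have "\<dots> = (\<Sum>i<M. \<Sum>j<M. scale (of_nat j * (c n i * c m j)) (e (i + j - 1) w))
      - (\<Sum>i<M. \<Sum>j<M. scale (of_nat i * (c m j * c n i)) (e (j + i - 1) w))"
    unfolding e_bracket sum_subtractf[symmetric]
    by (intro sum.cong refl) (simp add: algebra_simps flip: W.V.scale_left_diff_distrib)
  also have "\<dots> = scale (of_int m) (witt_exp scale act (n + m) w)
      - scale (of_int n) (witt_exp scale act (m + n) w)"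
    by (subst (2) sum.swap) (simp only: half)
  also have "\<dots> = scale (of_int (m - n)) (witt_exp scale act (n + m) w)"
    by (simp add: add.commute W.V.scale_left_diff_distrib)
  finally show ?thesis .
qed

lemma witt_exp_0: "witt_exp scale act 0 w = act (witt_d (-1)) w"
proof -
  obtain M where "\<And>i. i \<ge> M \<Longrightarrow> e i w = 0" using e_bound by blast
  then have M: "\<And>i. i \<ge> Suc M \<Longrightarrow> e i w = 0" by auto
  have "witt_exp scale act 0 w = (\<Sum>i<Suc M. scale (0 ^ i / fact i) (e i w))"
    using witt_exp_eq[of "Suc M" w 0] M by simp
  also have "\<dots> = (\<Sum>i\<in>{0}. scale (0 ^ i / fact i) (e i w))"
    by (rule sum.mono_neutral_right) auto
  finally show ?thesis by simp
qed

context
  fixes lam a b :: complex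
begin

private abbreviation "C \<equiv> loop_coeff scale act lam a b"
private abbreviation "E \<equiv> witt_exp scale act"
private abbreviation "B \<equiv> loop_basis_act scale act lam a b"

lemma linear_loop_coeff: "Vector_Spaces.linear scale scale (loop_coeff scale act lam a b k j)"
  by (rule linearI[OF W.V.vector_space_axioms W.V.vector_space_axioms])
    (simp_all add: loop_coeff_def linear_add[OF linear_witt_exp] linear_scale[OF linear_witt_exp]
      linear_add[OF W.linear_act_right] linear_scale[OF W.linear_act_right] algebra_simps
      W.V.scale_right_distrib W.V.scale_right_diff_distrib)

lemma loop_coeff_commute:
  assumes "lam \<noteq> 0"
  shows "loop_coeff scale act lam a b n (m + j) (loop_coeff scale act lam a b m j w)
      - loop_coeff scale act lam a b m (n + j) (loop_coeff scale act lam a b n j w)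
      = scale (of_int (m - n)) (loop_coeff scale act lam a b (m + n) j w)"
proof -
  note lin = linear_add[OF linear_witt_exp] linear_scale[OF linear_witt_exp]
    linear_diff[OF linear_witt_exp] linear_add[OF W.linear_act_right]
    linear_scale[OF W.linear_act_right] linear_diff[OF W.linear_act_right]
  have 1: "E n (E m w) = E m (E n w) + scale (of_int (m - n)) (E (n + m) w)"
    using witt_exp_commute[of n m w] by (simp add: algebra_simps)
  have 2: "E 0 (E k w) = E k (E 0 w) + scale (of_int k) (E k w)" for k
    using witt_exp_commute[of 0 k w] by (simp add: algebra_simps)
  have 3: "lam powi (m + n) = lam powi n * lam powi m"
    using assms by (simp add: power_int_add)
  define x where "x = E m (E n w)"
  define u v t where "u = E m (E 0 w)" and "v = E n (E 0 w)" and "t = E (n + m) w"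
  define p q where "p = E m w" and "q = E n w"
  define y z where "y = E 0 w" and "z = E 0 (E 0 w)"
  have eqs: "E n p = x + scale (of_int (m - n)) t" "E m q = x"
     "E 0 p = u + scale (of_int m) p" "E 0 q = v + scale (of_int n) q"
     "E m y = u" "E n y = v" "E 0 y = z" "E m w = p" "E n w = q" "E 0 w = y"
     "E (m + n) w = t"
    by (simp_all only: 1 2[of m] 2[of n] x_def u_def v_def t_def p_def q_def y_def z_def add.commute)
  show ?thesis
    unfolding loop_coeff_def witt_exp_0[symmetric]
    by (simp add: eqs lin 3 W.V.scale_right_distrib W.V.scale_right_diff_distrib
        W.V.scale_left_distrib W.V.scale_left_diff_distrib algebra_simps)
qed

private lemma basis_act_superset:
  assumes "finite A" "Poly_Mapping.keys f \<subseteq> A"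
  shows "B (D k) f = (\<Sum>j\<in>A. Poly_Mapping.single (k + j) (C k j (Poly_Mapping.lookup f j)))"
  unfolding loop_basis_act.simps
  by (rule sum.mono_neutral_left)
    (use assms in \<open>auto simp: in_keys_iff linear_zero[OF linear_loop_coeff]\<close>)

lemma vector_space_loop: "vector_space (pm_scale scale)"
  by (rule vector_space_pm_scale[OF W.V.vector_space_axioms])

lemma linear_loop_basis_act:
  "Vector_Spaces.linear (pm_scale scale) (pm_scale scale) (loop_basis_act scale act lam a b p)"
proof (rule linearI[OF vector_space_loop vector_space_loop])
  interpret P: vector_space "pm_scale scale :: _ \<Rightarrow> (int \<Rightarrow>\<^sub>0 'w) \<Rightarrow> _" by (rule vector_space_loop)
  note pm = lookup_pm_scale[where s = scale, OF W.V.scale_zero_right]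
    pm_scale_single[where s = scale, OF W.V.scale_zero_right]
  fix f g :: "int \<Rightarrow>\<^sub>0 'w" and c
  let ?A = "Poly_Mapping.keys f \<union> Poly_Mapping.keys g"
  have "Poly_Mapping.keys (f + g) \<subseteq> ?A" by (rule Poly_Mapping.keys_add)
  then show "B p (f + g) = B p f + B p g"
    by (cases p)
      (simp_all add: basis_act_superset[of ?A] lookup_add linear_add[OF linear_loop_coeff]
        single_add sum.distrib del: loop_basis_act.simps(1))
  have "Poly_Mapping.keys (pm_scale scale c f) \<subseteq> Poly_Mapping.keys f"
    by (auto simp: in_keys_iff pm)
  then show "B p (pm_scale scale c f) = pm_scale scale c (B p f)"
    by (cases p)
      (simp_all add: basis_act_superset[of "Poly_Mapping.keys f"] pm P.scale_sum_right
        linear_scale[OF linear_loop_coeff] del: loop_basis_act.simps(1))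
qed

lemma loop_act_d:
  "loop_act scale act lam a b (vir_d k) (Poly_Mapping.single j w) =
     Poly_Mapping.single (k + j) (loop_coeff scale act lam a b k j w)"
  and loop_act_z: "loop_act scale act lam a b vir_z f = 0"
proof -
  interpret P: vector_space "pm_scale scale :: _ \<Rightarrow> (int \<Rightarrow>\<^sub>0 'w) \<Rightarrow> _" by (rule vector_space_loop)
  show "loop_act scale act lam a b (vir_d k) (Poly_Mapping.single j w) =
     Poly_Mapping.single (k + j) (loop_coeff scale act lam a b k j w)"
    by (simp add: loop_act_def vir_d_def linear_ext_single[OF vector_space_loop]
        linear_zero[OF linear_loop_coeff])
  show "loop_act scale act lam a b vir_z f = 0"
    by (simp add: loop_act_def vir_z_def linear_ext_single[OF vector_space_loop])
qed

theorem loop_lie_module: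
  assumes "lam \<noteq> 0"
  shows "lie_module vir_scale vir_bracket (pm_scale scale) (loop_act scale act lam a b)"
proof (rule lie_module.intro[OF vir_lie_algebra vector_space_loop], rule lie_module_axioms.intro)
  interpret P: vector_space "pm_scale scale :: _ \<Rightarrow> (int \<Rightarrow>\<^sub>0 'w) \<Rightarrow> _" by (rule vector_space_loop)
  let ?A = "loop_act scale act lam a b"
  have L: "Vector_Spaces.linear vir_scale (pm_scale scale) (\<lambda>x. ?A x v)" for v
    unfolding loop_act_def by (intro linear_linear_ext vector_space_loop)
  have R: "Vector_Spaces.linear (pm_scale scale) (pm_scale scale) (?A x)" for x
    unfolding loop_act_def
    by (intro linear_linear_ext_right vector_space_loop linear_loop_basis_act)
  note lin = linear_add[OF R] linear_add[OF L] linear_scale[OF R] linear_scale[OF L]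
    linear_zero[OF R] linear_zero[OF L] linear_add[OF linear_vir_bracket_left]
    linear_add[OF linear_vir_bracket_right] linear_scale[OF linear_vir_bracket_left]
    linear_scale[OF linear_vir_bracket_right] linear_zero[OF linear_vir_bracket_left]
    linear_zero[OF linear_vir_bracket_right]
  fix x y v
  show "Vector_Spaces.linear vir_scale (pm_scale scale) (\<lambda>x. ?A x v)" by (rule L)
  show "Vector_Spaces.linear (pm_scale scale) (pm_scale scale) (?A x)" by (rule R)
  define K where "K x y v = ?A (vir_bracket x y) v - (?A x (?A y v) - ?A y (?A x v))" for x y v
  note pms = pm_scale_single[where s = scale, OF W.V.scale_zero_right]
  have KD: "K (vir_d n) (vir_d m) (Poly_Mapping.single j w) = 0" for n m j w
    using loop_coeff_commute[OF assms, of n m j w]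
    by (simp add: K_def vir_bracket_d_d lin loop_act_d loop_act_z pms add.left_commute[of n m]
        add.assoc flip: single_diff)
  have K1: "K (Poly_Mapping.single p 1) (Poly_Mapping.single q 1) (Poly_Mapping.single j w) = 0"
    for p q j w
    using KD by (cases p; cases q)
      (auto simp: K_def lin vir_bracket_z loop_act_z simp flip: vir_z_def vir_d_def)
  have K_lin: "K (x + x') y v = K x y v + K x' y v" "K x (y + y') v = K x y v + K x y' v"
    "K x y (v + v') = K x y v + K x y v'"
    "K (vir_scale c x) y v = pm_scale scale c (K x y v)"
    "K x (vir_scale c y) v = pm_scale scale c (K x y v)"
    "K 0 y v = 0" "K x 0 v = 0" "K x y 0 = 0" for c x y v x' y' v'
    by (simp_all add: K_def lin P.scale_right_diff_distrib algebra_simps)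
  note sg = vir_scale_single[of _ _ 1, simplified, symmetric]
  have "K x y v = 0"
  proof (induction x rule: pm_induct)
    case (single p c)
    show ?case
    proof (induction y rule: pm_induct)
      case (single q d)
      have "K (Poly_Mapping.single p 1) (Poly_Mapping.single q 1) v = 0"
        by (induction v rule: pm_induct) (simp_all add: K_lin K1)
      then show ?case
        by (simp add: sg[of p c] sg[of q d] K_lin)
    qed (simp_all add: K_lin)
  qed (simp_all add: K_lin)
  then show "?A (vir_bracket x y) v = ?A x (?A y v) - ?A y (?A x v)"
    by (simp add: K_def)
qed

end
end

end

theory Submission
  imports Defs
begin

text \<open>Write \<open>e\<^sub>i = t\<^sup>i d/dt\<close>, \<open>E\<^sub>k = e\<^sup>k\<^sup>t d/dt = \<Sum>\<^sub>i k\<^sup>i/i! e\<^sub>i\<close> and let \<open>C k j\<close> be the map \<open>W \<rightarrow> W\<close>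
by which \<open>d\<^sub>k\<close> moves degree \<open>j\<close> to degree \<open>k + j\<close>. The operator \<open>d\<^sub>0\<close> acts on degree \<open>j\<close> as the
scalar \<open>a + j\<close>, so a submodule \<open>N\<close> is the same thing as a family of subspaces \<open>N\<^sub>j\<close> of \<open>W\<close> with
\<open>C k j N\<^sub>j \<subseteq> N\<^sub>k\<^sub>+\<^sub>j\<close>.

For \<open>lam = 1\<close> the operator \<open>e\<^sub>0\<close> drops out of \<open>C k j\<close>, and for suitable \<open>n\<close> the subspace killed
by all \<open>e\<^sub>i\<close> with \<open>i \<ge> n\<close>, which is stable under \<open>e\<^sub>1, e\<^sub>2, \<dots>\<close>, gives a proper family
(\<open>not_simple_lam_1\<close>). For \<open>b = 1\<close> the images of \<open>e\<^sub>0 - a - j\<close> form a family; they are proper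
because \<open>e\<^sub>0 - c\<close> raises the largest index \<open>i\<close> with \<open>e\<^sub>i w \<noteq> 0\<close> by exactly one
(\<open>not_simple_b_1\<close>).

To prove simplicity, let \<open>w \<in> N\<^sub>j\<close> and fix \<open>s\<close>. The composite \<open>d\<^sub>s\<^sub>-\<^sub>k d\<^sub>k\<close> sends \<open>w\<close> into
\<open>N\<^sub>j\<^sub>+\<^sub>s\<close> for every integer \<open>k\<close>, and as a function of \<open>k\<close> it has the form
\<open>P(k) + lam\<^sup>k Q(k) + lam\<^sup>-\<^sup>k R(k)\<close> with polynomial \<open>P, Q, R\<close>. If \<open>lam \<noteq> 1, -1\<close> the three
exponentials are independent, so the values, and then the coefficients, of \<open>Q\<close> lie in \<open>N\<^sub>j\<^sub>+\<^sub>s\<close>.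
The leading coefficient of \<open>Q\<close> is a multiple of \<open>e\<^sub>r w\<close>, with \<open>r\<close> the largest index such that
\<open>e\<^sub>r w \<noteq> 0\<close>, and the factor is nonzero as \<open>b \<noteq> 1\<close>; hence the intersection of all \<open>N\<^sub>j\<close> is
nonzero. On that intersection the remaining coefficients show that it is a submodule of \<open>W\<close>, so
it is \<open>W\<close> (\<open>generic_submodule_UNIV\<close>).

For \<open>lam = -1\<close> one has \<open>lam\<^sup>k = lam\<^sup>-\<^sup>k\<close> and only \<open>Q + R\<close> can be separated. The same argument
yields a nonzero vector lying in \<open>N\<^sub>j\<close> for all \<open>j\<close> of one parity, and the coefficients of
\<open>Q + R\<close> give the relations in \<open>half_common_relations\<close>. If the intersection of all \<open>N\<^sub>j\<close> is
nonzero, it is again all of \<open>W\<close>. Otherwise the relations force the vector to be a highest weight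
vector of weight \<open>b - 1\<close> (\<open>minus_one_submodule\<close>).

It remains to understand this exceptional case. For \<open>W\<close> of highest weight \<open>b'\<close> identify
\<open>p(e\<^sub>0) w\<^sub>0\<close> with the polynomial \<open>p\<close>. Then \<open>E\<^sub>k p(x) = (x + k b') p(x - k)\<close>, and for \<open>lam = -1\<close>,
\<open>b = b' + 1\<close> the involution \<open>p(x) t\<^sup>j \<mapsto> (-1)\<^sup>j p(a + j - x) t\<^sup>j\<close> commutes with the Virasoro
algebra. The two submodules of the theorem are its eigenspaces (\<open>loop_half_eq_half\<close>), because
\<open>d\<^sub>1\<^sup>i (w\<^sub>0 \<otimes> t\<^sup>j)\<close> has degree exactly \<open>i\<close> as a polynomial. A proper nonzero submodule contains
\<open>w\<^sub>0 \<otimes> t\<^sup>j\<close> for all \<open>j\<close> of one parity, hence an eigenspace; if it were larger than that, it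
would meet the other eigenspace and contain \<open>w\<^sub>0 \<otimes> t\<^sup>j\<close> for all \<open>j\<close>.\<close>

section \<open>Polynomial and exponential sequences in a vector space\<close>

locale vector_space_char_0 = vector_space scale
  for scale :: "'k::field_char_0 \<Rightarrow> 'v::ab_group_add \<Rightarrow> 'v"
begin

lemma subspace_scale_cancel:
  assumes "subspace N" "scale c v \<in> N" "c \<noteq> 0"
  shows "v \<in> N"
  using subspace_scale[OF assms(1,2), of "inverse c"] assms(3) by simp

lemma subspace_eigenvectors:
  assumes N: "subspace N" and T: "Vector_Spaces.linear scale scale T" "\<And>x. x \<in> N \<Longrightarrow> T x \<in> N"
    and "finite I" "inj_on c I" "\<And>i. i \<in> I \<Longrightarrow> T (v i) = scale (c i) (v i)"
    and "(\<Sum>i\<in>I. v i) \<in> N" "i \<in> I"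
  shows "v i \<in> N"
  using assms(4-)
proof (induction I arbitrary: v i)
  case (insert x I)
  let ?s = "\<Sum>i\<in>insert x I. v i"
  have "T ?s - scale (c x) ?s = (\<Sum>i\<in>I. scale (c i - c x) (v i))"
    using insert.hyps insert.prems(2)
    by (simp add: linear_add[OF T(1)] linear_sum[OF T(1)] scale_right_distrib scale_sum_right
        scale_left_diff_distrib sum_subtractf)
  moreover have "T ?s - scale (c x) ?s \<in> N"
    using insert.prems(3) by (intro subspace_diff[OF N] T(2) subspace_scale[OF N])
  ultimately have "(\<Sum>i\<in>I. scale (c i - c x) (v i)) \<in> N" by simp
  then have "scale (c j - c x) (v j) \<in> N" if "j \<in> I" for j
    using insert.prems(1,2) that
    by (intro insert.IH[of "\<lambda>i. scale (c i - c x) (v i)"])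
      (auto simp: linear_scale[OF T(1)] mult.commute)
  moreover have "c j \<noteq> c x" if "j \<in> I" for j
    using insert.prems(1) insert.hyps(2) that by (auto simp: inj_on_def)
  ultimately have I: "v j \<in> N" if "j \<in> I" for j
    using that subspace_scale_cancel[OF N] by (metis right_minus_eq)
  have "?s - (\<Sum>i\<in>I. v i) \<in> N"
    by (intro subspace_diff[OF N] insert.prems(3) subspace_sum[OF N] I)
  then have "v x \<in> N" using insert.hyps by simp
  then show ?case using I insert.prems(4) by auto
qed simp

text \<open>Replacing \<open>k\<close> by \<open>2 k\<close> and subtracting \<open>2\<^sup>n\<close> times the original value removes the term of degree
\<open>n\<close> and multiplies the coefficient of degree \<open>i\<close> by \<open>2\<^sup>i - 2\<^sup>n \<noteq> 0\<close>.\<close>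

lemma subspace_poly_coeff:
  assumes N: "subspace N" and "\<And>k::int. (\<Sum>i<n. scale (of_int k ^ i) (v i)) \<in> N" and "i < n"
  shows "v i \<in> N"
  using assms(2,3)
proof (induction n arbitrary: v i)
  case (Suc n)
  let ?g = "\<lambda>k::int. \<Sum>i<Suc n. scale (of_int k ^ i) (v i)"
  have "(\<Sum>i<n. scale (of_int k ^ i) (scale (2 ^ i - 2 ^ n) (v i))) \<in> N" for k
  proof -
    have "?g (2 * k) - scale (2 ^ n) (?g k) =
        (\<Sum>i<Suc n. scale (of_int k ^ i) (scale (2 ^ i - 2 ^ n) (v i)))"
      by (simp only: scale_sum_right sum_subtractf[symmetric] scale_scale
          scale_left_diff_distrib[symmetric])
        (intro sum.cong refl arg_cong2[where f = scale], simp add: power_mult_distrib algebra_simps)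
    moreover have "?g (2 * k) - scale (2 ^ n) (?g k) \<in> N"
      by (intro subspace_diff[OF N] subspace_scale[OF N] Suc.prems(1))
    ultimately show ?thesis by simp
  qed
  then have *: "scale (2 ^ j - 2 ^ n) (v j) \<in> N" if "j < n" for j
    by (rule Suc.IH) (rule that)
  have lt: "v j \<in> N" if "j < n" for j
  proof (rule subspace_scale_cancel[OF N *[OF that]])
    have "(2::nat) ^ j \<noteq> 2 ^ n" using that by simp
    then have "(of_nat (2 ^ j) :: 'k) \<noteq> of_nat (2 ^ n)" by (simp only: of_nat_eq_iff not_False_eq_True)
    then show "(2 ^ j - 2 ^ n :: 'k) \<noteq> 0" by simp
  qed
  have "?g 1 - (\<Sum>i<n. v i) \<in> N"
    by (intro subspace_diff[OF N] subspace_sum[OF N] Suc.prems(1) lt) simp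
  then show ?case using lt Suc.prems(2) by (cases "i = n") auto
qed simp

text \<open>The \<open>n\<close>-th finite difference of \<open>g\<close> is constantly \<open>v\<close>, that is, \<open>g\<close> is a polynomial of degree at
most \<open>n\<close> in its integer argument with coefficient \<open>v/n!\<close> in degree \<open>n\<close>. This form allows leading
coefficients to be computed without expanding products such as \<open>(s - k)\<^sup>i\<close>.\<close>

primrec top_diff :: "nat \<Rightarrow> 'v \<Rightarrow> (int \<Rightarrow> 'v) \<Rightarrow> bool" where
  "top_diff 0 v g \<longleftrightarrow> (\<forall>k. g k = v)"
| "top_diff (Suc n) v g \<longleftrightarrow> top_diff n v (\<lambda>k. g (k + 1) - g k)"

lemma top_diff_add:
  "top_diff n u g \<Longrightarrow> top_diff n v h \<Longrightarrow> top_diff n (u + v) (\<lambda>k. g k + h k)"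
proof (induction n arbitrary: g h)
  case (Suc n)
  have "(\<lambda>k. g (k + 1) + h (k + 1) - (g k + h k)) = (\<lambda>k. (g (k + 1) - g k) + (h (k + 1) - h k))"
    by (simp add: fun_eq_iff)
  then show ?case using Suc by simp
qed simp

lemma top_diff_linear:
  assumes "Vector_Spaces.linear scale scale T"
  shows "top_diff n u g \<Longrightarrow> top_diff n (T u) (\<lambda>k. T (g k))"
  by (induction n arbitrary: g) (simp_all add: linear_diff[OF assms, symmetric])

lemma top_diff_scale: "top_diff n u g \<Longrightarrow> top_diff n (scale c u) (\<lambda>k. scale c (g k))"
  by (rule top_diff_linear)
    (simp_all add: linearI[OF vector_space_axioms vector_space_axioms] scale_right_distrib mult.commute)

lemma top_diff_shift: "top_diff n u g \<Longrightarrow> top_diff n u (\<lambda>k. g (k + 1))"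
proof (induction n arbitrary: g)
  case (Suc n)
  from Suc.IH[of "\<lambda>k. g (k + 1) - g k"] Suc.prems show ?case by simp
qed simp

lemma top_diff_Suc: "top_diff n u g \<Longrightarrow> top_diff (Suc n) 0 g"
proof (induction n arbitrary: g)
  case (Suc n)
  from Suc.IH[of "\<lambda>k. g (k + 1) - g k"] Suc.prems show ?case by simp
qed simp

lemma top_diff_less: "top_diff n u g \<Longrightarrow> n < m \<Longrightarrow> top_diff m 0 g"
proof (induction m)
  case (Suc m)
  then show ?case using top_diff_Suc by (cases "n = m") (auto simp del: top_diff.simps)
qed simp

lemma top_diff_affine:
  "top_diff n u g \<Longrightarrow>
     top_diff (Suc n) (scale (of_nat (Suc n) * d) u) (\<lambda>k. scale (c + of_int k * d) (g k))"
proof (induction n arbitrary: g)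
  case 0
  then show ?case by (simp add: scale_left_distrib algebra_simps)
next
  case (Suc n)
  have "(\<lambda>k. scale (c + of_int (k + 1) * d) (g (k + 1)) - scale (c + of_int k * d) (g k)) =
      (\<lambda>k. scale (c + of_int k * d) (g (k + 1) - g k) + scale d (g (k + 1)))"
    by (simp add: fun_eq_iff scale_left_distrib scale_right_diff_distrib algebra_simps)
  moreover have "top_diff (Suc n) (scale (of_nat (Suc n) * d) u + scale d u)
      (\<lambda>k. scale (c + of_int k * d) (g (k + 1) - g k) + scale d (g (k + 1)))"
  proof (rule top_diff_add)
    show "top_diff (Suc n) (scale (of_nat (Suc n) * d) u)
        (\<lambda>k. scale (c + of_int k * d) (g (k + 1) - g k))"
      using Suc.prems by (intro Suc.IH) simp
    show "top_diff (Suc n) (scale d u) (\<lambda>k. scale d (g (k + 1)))"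
      by (rule top_diff_scale[OF top_diff_shift[OF Suc.prems]])
  qed
  moreover have "scale (of_nat (Suc n) * d) u + scale d u = scale (of_nat (Suc (Suc n)) * d) u"
    by (simp add: distrib_right flip: scale_left_distrib)
  ultimately show ?case
    by (subst top_diff.simps(2)) (simp del: top_diff.simps of_nat_Suc)
qed

lemma top_diff_affine_power:
  "top_diff i (scale (fact i * d ^ i) u) (\<lambda>k. scale ((c + of_int k * d) ^ i) u)"
proof (induction i)
  case (Suc i)
  then show ?case
    using top_diff_affine[OF Suc.IH, of d c] by (simp add: algebra_simps del: top_diff.simps)
qed simp

lemma top_diff_sum:
  "finite I \<Longrightarrow> (\<And>i. i \<in> I \<Longrightarrow> top_diff n (u i) (g i)) \<Longrightarrow>
    top_diff n (\<Sum>i\<in>I. u i) (\<lambda>k. \<Sum>i\<in>I. g i k)"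
proof (induction I rule: finite_induct)
  case empty
  show ?case using top_diff_less[of 0 0 "\<lambda>_. 0" n] by (cases n) (auto simp del: top_diff.simps(2))
qed (simp add: top_diff_add)

lemma top_diff_mem:
  assumes N: "subspace N"
  shows "top_diff n u g \<Longrightarrow> (\<And>k. g k \<in> N) \<Longrightarrow> u \<in> N"
proof (induction n arbitrary: g)
  case 0
  then show ?case by (metis top_diff.simps(1))
next
  case (Suc n)
  show ?case
    by (rule Suc.IH[of "\<lambda>k. g (k + 1) - g k"]) (use Suc.prems in \<open>auto intro: subspace_diff[OF N]\<close>)
qed

definition polynomial_seq :: "(int \<Rightarrow> 'v) \<Rightarrow> bool" where
  "polynomial_seq g \<longleftrightarrow> (\<exists>n. top_diff n 0 g)"

lemma polynomial_seqI: "top_diff n u g \<Longrightarrow> polynomial_seq g"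
  using top_diff_Suc unfolding polynomial_seq_def by blast

lemma polynomial_seq_const: "polynomial_seq (\<lambda>_. u)"
  by (rule polynomial_seqI[of 0 u]) simp

lemma polynomial_seq_add:
  assumes "polynomial_seq g" "polynomial_seq h"
  shows "polynomial_seq (\<lambda>k. g k + h k)"
proof -
  obtain n m where "top_diff n 0 g" "top_diff m 0 h"
    using assms by (auto simp: polynomial_seq_def)
  then have "top_diff (Suc (max n m)) (0 + 0) (\<lambda>k. g k + h k)"
    by (intro top_diff_add) (erule top_diff_less, simp)+
  then show ?thesis by (rule polynomial_seqI)
qed

lemma polynomial_seq_sum:
  "(\<And>i. i \<in> I \<Longrightarrow> polynomial_seq (g i)) \<Longrightarrow> polynomial_seq (\<lambda>k. \<Sum>i\<in>I. g i k)"
  by (induction I rule: infinite_finite_induct)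
    (auto intro: polynomial_seq_const polynomial_seq_add)

lemma polynomial_seq_linear:
  "Vector_Spaces.linear scale scale T \<Longrightarrow> polynomial_seq g \<Longrightarrow> polynomial_seq (\<lambda>k. T (g k))"
  unfolding polynomial_seq_def using top_diff_linear polynomial_seqI polynomial_seq_def by meson

lemma polynomial_seq_affine:
  "polynomial_seq g \<Longrightarrow> polynomial_seq (\<lambda>k. scale (c + of_int k * d) (g k))"
  using top_diff_affine polynomial_seqI unfolding polynomial_seq_def by meson

lemma polynomial_seq_scale: "polynomial_seq g \<Longrightarrow> polynomial_seq (\<lambda>k. scale c (g k))"
  using polynomial_seq_affine[of g c 0] by simp

lemma polynomial_seq_shift: "polynomial_seq g \<Longrightarrow> polynomial_seq (\<lambda>k. g (k + 1))"
  using top_diff_shift unfolding polynomial_seq_def by blast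

lemma polynomial_seq_diff:
  "polynomial_seq g \<Longrightarrow> polynomial_seq h \<Longrightarrow> polynomial_seq (\<lambda>k. g k - h k)"
  using polynomial_seq_add[of g "\<lambda>k. scale (- 1) (h k)"] polynomial_seq_scale[of h "- 1"] by simp

lemma polynomial_seq_affine_power:
  "polynomial_seq g \<Longrightarrow> polynomial_seq (\<lambda>k. scale ((c + of_int k * d) ^ i) (g k))"
proof (induction i)
  case (Suc i)
  then show ?case
    using polynomial_seq_affine[of "\<lambda>k. scale ((c + of_int k * d) ^ i) (g k)" c d] by simp
qed simp

text \<open>On polynomial sequences the shift is unipotent, so \<open>\<mu>\<close> times the shift minus the identity is
invertible when \<open>\<mu> \<noteq> 1\<close>. The induction on the degree applies the claim to the difference
sequence of \<open>Q\<close>.\<close>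

lemma twisted_diff_mem:
  assumes N: "subspace N" and "\<mu> \<noteq> 1"
  shows "top_diff n 0 Q \<Longrightarrow> (\<And>k. scale \<mu> (Q (k + 1)) - Q k \<in> N) \<Longrightarrow> Q k \<in> N"
proof (induction n arbitrary: Q k)
  case 0
  then show ?case using subspace_0[OF N] by simp
next
  case (Suc n)
  have "Q (k + 1) - Q k \<in> N" for k
  proof (rule Suc.IH[of "\<lambda>k. Q (k + 1) - Q k"])
    fix k
    have "scale \<mu> (Q (k + 1 + 1)) - Q (k + 1) - (scale \<mu> (Q (k + 1)) - Q k) \<in> N"
      by (intro subspace_diff[OF N] Suc.prems)
    then show "scale \<mu> (Q (k + 1 + 1) - Q (k + 1)) - (Q (k + 1) - Q k) \<in> N"
      by (simp add: scale_right_diff_distrib algebra_simps)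
  qed (use Suc.prems in simp)
  then have "scale \<mu> (Q (k + 1)) - Q k - scale \<mu> (Q (k + 1) - Q k) \<in> N"
    by (blast intro: subspace_diff[OF N] Suc.prems subspace_scale[OF N])
  then have "scale (\<mu> - 1) (Q k) \<in> N"
    by (simp add: scale_right_diff_distrib scale_left_diff_distrib)
  then show ?case by (rule subspace_scale_cancel[OF N]) (use \<open>\<mu> \<noteq> 1\<close> in simp)
qed

lemma exp_diff:
  assumes "\<mu> \<noteq> 0"
  shows "scale (\<mu> powi (k + 1)) (Q (k + 1)) - scale (\<mu> powi k) (Q k) =
    scale (\<mu> powi k) (scale \<mu> (Q (k + 1)) - Q k)"
  using assms by (simp add: power_int_add scale_right_diff_distrib)

text \<open>Each application of the difference operator lowers the degree of \<open>P\<close> and turns \<open>\<mu>\<^sup>k Q(k)\<close> into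
\<open>\<mu>\<^sup>k Q'(k)\<close> with \<open>Q'(k) = \<mu> Q(k + 1) - Q(k)\<close>, from which \<open>Q\<close> is recovered by \<open>twisted_diff_mem\<close>.\<close>

lemma exp_polynomial_separate2:
  assumes N: "subspace N" and \<mu>: "\<mu> \<noteq> 1" "\<mu> \<noteq> 0"
  assumes "top_diff n 0 P" "polynomial_seq Q" "\<And>k. P k + scale (\<mu> powi k) (Q k) \<in> N"
  shows "Q k \<in> N"
  using assms(4-)
proof (induction n arbitrary: P Q k)
  case 0
  then have "scale (\<mu> powi k) (Q k) \<in> N" by (metis add_0 top_diff.simps(1))
  then show ?case by (rule subspace_scale_cancel[OF N]) (use \<mu> in simp)
next
  case (Suc n)
  have "scale \<mu> (Q (k + 1)) - Q k \<in> N" for k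
  proof (rule Suc.IH[of "\<lambda>k. P (k + 1) - P k"])
    show "polynomial_seq (\<lambda>k. scale \<mu> (Q (k + 1)) - Q k)"
      by (intro polynomial_seq_diff polynomial_seq_scale polynomial_seq_shift Suc.prems)
    fix k
    have "(P (k + 1) + scale (\<mu> powi (k + 1)) (Q (k + 1))) - (P k + scale (\<mu> powi k) (Q k)) \<in> N"
      by (intro subspace_diff[OF N] Suc.prems)
    then show "P (k + 1) - P k + scale (\<mu> powi k) (scale \<mu> (Q (k + 1)) - Q k) \<in> N"
      by (simp only: exp_diff[of \<mu> k Q, OF \<mu>(2), symmetric]) (simp only: algebra_simps)
  qed (use Suc.prems in simp)
  with Suc.prems(2) show ?case
    using twisted_diff_mem[OF N \<mu>(1)] by (auto simp: polynomial_seq_def)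
qed

text \<open>Once \<open>P\<close> has been differenced away, multiplication by \<open>\<mu>\<^sup>k\<close> leaves the two exponentials \<open>1\<close> and
\<open>\<mu>\<^sup>2\<^sup>k\<close>, which differ because \<open>\<mu>\<^sup>2 \<noteq> 1\<close>.\<close>

lemma exp_polynomial_separate3:
  assumes N: "subspace N" and \<mu>: "\<mu> \<noteq> 1" "\<mu> \<noteq> - 1" "\<mu> \<noteq> 0"
  assumes "top_diff n 0 P" "polynomial_seq Q" "polynomial_seq R"
    and "\<And>k. P k + scale (\<mu> powi k) (Q k) + scale (inverse \<mu> powi k) (R k) \<in> N"
  shows "Q k \<in> N"
  using assms(5-)
proof (induction n arbitrary: P Q R k)
  case 0
  obtain m where m: "top_diff m 0 R" using 0 by (auto simp: polynomial_seq_def)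
  have "R k + scale ((\<mu> * \<mu>) powi k) (Q k) \<in> N" for k
  proof -
    \<comment> \<open>The polynomial \<open>P\<close> vanishes here.\<close>
    have "scale (\<mu> powi k) (P k + scale (\<mu> powi k) (Q k) + scale (inverse \<mu> powi k) (R k)) \<in> N"
      by (intro subspace_scale[OF N] 0)
    moreover have "\<mu> powi k * inverse \<mu> powi k = 1"
      using \<mu> by (simp flip: power_int_mult_distrib)
    ultimately show ?thesis
      using 0(1) by (simp add: scale_right_distrib power_int_mult_distrib add.commute)
  qed
  moreover have "\<mu> * \<mu> \<noteq> 1" using \<mu> by (metis square_eq_1_iff)
  moreover have "\<mu> * \<mu> \<noteq> 0" using \<mu> by simp
  ultimately show ?case
    using exp_polynomial_separate2[OF N _ _ m 0(2)] by blast
next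
  case (Suc n)
  have "scale \<mu> (Q (k + 1)) - Q k \<in> N" for k
  proof (rule Suc.IH[of "\<lambda>k. P (k + 1) - P k" _ "\<lambda>k. scale (inverse \<mu>) (R (k + 1)) - R k"])
    show "polynomial_seq (\<lambda>k. scale \<mu> (Q (k + 1)) - Q k)"
      "polynomial_seq (\<lambda>k. scale (inverse \<mu>) (R (k + 1)) - R k)"
      by (intro polynomial_seq_diff polynomial_seq_scale polynomial_seq_shift Suc.prems)+
    fix k
    have "(P (k + 1) + scale (\<mu> powi (k + 1)) (Q (k + 1)) + scale (inverse \<mu> powi (k + 1)) (R (k + 1)))
        - (P k + scale (\<mu> powi k) (Q k) + scale (inverse \<mu> powi k) (R k)) \<in> N"
      by (intro subspace_diff[OF N] Suc.prems)
    moreover have i: "inverse \<mu> \<noteq> 0" using \<mu> by simp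
    ultimately show "P (k + 1) - P k + scale (\<mu> powi k) (scale \<mu> (Q (k + 1)) - Q k)
        + scale (inverse \<mu> powi k) (scale (inverse \<mu>) (R (k + 1)) - R k) \<in> N"
      by (simp only: exp_diff[of \<mu> k Q, OF \<mu>(3), symmetric]
          exp_diff[of "inverse \<mu>" k R, OF i, symmetric])
        (simp only: algebra_simps)
  qed (use Suc.prems in simp)
  with Suc.prems(2) show ?case
    using twisted_diff_mem[OF N \<mu>(1)] by (auto simp: polynomial_seq_def)
qed

text \<open>If \<open>g\<close> takes values in \<open>N\<close> on one parity class, then \<open>g(k) + (-1)\<^sup>k\<^sup>+\<^sup>c g(k)\<close> lies in \<open>N\<close> for
all \<open>k\<close>, and the exponentials \<open>1\<close> and \<open>(-1)\<^sup>k\<close> can be separated.\<close>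

lemma polynomial_seq_mem_parity:
  assumes N: "subspace N" and g: "polynomial_seq g" "\<And>k. even (k + c) \<Longrightarrow> g k \<in> N"
  shows "g k \<in> N"
proof -
  obtain n where n: "top_diff n 0 g" using g by (auto simp: polynomial_seq_def)
  have "scale ((- 1) powi c) (g k) \<in> N"
  proof (rule exp_polynomial_separate2[OF N _ _ n])
    show "g k + scale ((- 1) powi k) (scale ((- 1) powi c) (g k)) \<in> N" for k
    proof (cases "even (k + c)")
      case True
      then show ?thesis by (intro subspace_add[OF N] subspace_scale[OF N] g)
    next
      case False
      then have "(- 1 :: 'k) powi k * (- 1) powi c = - 1"
        by (simp flip: power_int_add add: power_int_minus_left)
      then show ?thesis by (simp add: subspace_0[OF N])
    qed
  qed (simp_all add: polynomial_seq_scale g)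
  then show ?thesis by (rule subspace_scale_cancel[OF N]) simp
qed

end

section \<open>Modules over the derivations of polynomials\<close>

locale witt_O_module =
  fixes scale :: "complex \<Rightarrow> 'w::ab_group_add \<Rightarrow> 'w" and act :: "complex poly \<Rightarrow> 'w \<Rightarrow> 'w"
  assumes O: "in_O_witt scale act"
begin

sublocale V: vector_space_char_0 scale
  using O by (simp add: in_O_witt_def lie_module_def vector_space_char_0_def)

sublocale W: lie_module smult witt_bracket scale act
  using O by (simp add: in_O_witt_def)

text \<open>The index is the power of \<open>t\<close>: \<open>e i\<close> is the action of \<open>t\<^sup>i d/dt\<close>, which is the element of index
\<open>i - 1\<close> in the usual basis. The index then agrees with the exponent of \<open>k\<close> in \<open>E k\<close>.\<close>

definition e :: "nat \<Rightarrow> 'w \<Rightarrow> 'w" where "e i = act (monom 1 i)"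

abbreviation E :: "int \<Rightarrow> 'w \<Rightarrow> 'w" where "E \<equiv> witt_exp scale act"

lemma act_witt_d: "act (witt_d (int i - 1)) = e i"
  by (simp add: witt_d_def e_def)

lemma e_linear: "Vector_Spaces.linear scale scale (e i)"
  unfolding e_def by (rule W.linear_act_right)

lemma e_commute:
  "e i (e j w) = e j (e i w) + scale (of_int (int j - int i)) (e (i + j - 1) w)"
proof -
  have "witt_bracket (monom 1 i) (monom 1 j) = smult (of_int (int j - int i)) (monom 1 (i + j - 1))"
  proof (cases "i = 0 \<and> j = 0")
    case True
    then show ?thesis by (simp add: witt_bracket_def)
  next
    case False
    then have "nat (int i + int j - 1) = i + j - 1" by auto
    with witt_bracket_d[of "int i - 1" "int j - 1"] show ?thesis
      by (simp add: witt_d_def algebra_simps)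
  qed
  then have "act (witt_bracket (monom 1 i) (monom 1 j)) w
      = scale (of_int (int j - int i)) (e (i + j - 1) w)"
    unfolding e_def by (simp only: linear_scale[OF W.linear_act_left])
  then show ?thesis unfolding e_def by (simp only: W.act_bracket) (simp only: algebra_simps)
qed

lemma e_e0: "e j (e 0 w) = e 0 (e j w) - scale (of_nat j) (e (j - 1) w)"
  using e_commute[of 0 j w] by simp

lemmas E_linear = linear_witt_exp[OF O]

lemma e_bound: "\<exists>M. \<forall>i\<ge>M. e i w = 0"
proof -
  obtain n :: nat where n: "\<And>i. i \<ge> int n \<Longrightarrow> act (witt_d i) w = 0"
    using O by (force simp: in_O_witt_def)
  have "e i w = 0" if "i \<ge> Suc n" for i
    using n[of "int i - 1"] that by (simp add: act_witt_d)
  then show ?thesis by blast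
qed

lemma E_eq:
  assumes "\<And>i. i \<ge> M \<Longrightarrow> e i w = 0"
  shows "E k w = (\<Sum>i<M. scale (of_int k ^ i / fact i) (e i w))"
  using witt_exp_eq[OF O, of M w k] assms by (simp add: act_witt_d)

lemma E_0: "E 0 w = e 0 w"
  using act_witt_d[of 0] by (simp add: witt_exp_0[OF O])

lemma E_e0: "E k (e 0 w) = e 0 (E k w) - scale (of_int k) (E k w)"
  using witt_exp_commute[OF O, of 0 k w] by (simp add: E_0 algebra_simps)

text \<open>The \<open>e i\<close> are, up to factorials, the coefficients of the polynomial \<open>k \<mapsto> E k w\<close>.\<close>

lemma e_mem_of_E:
  assumes N: "V.subspace N" and E: "\<And>k. E k w \<in> N"
  shows "e i w \<in> N"
proof -
  obtain M where M: "\<And>i. i \<ge> M \<Longrightarrow> e i w = 0" using e_bound by blast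
  show ?thesis
  proof (cases "i < M")
    case True
    have "scale (1 / fact i) (e i w) \<in> N"
      by (rule V.subspace_poly_coeff[OF N _ True, of "\<lambda>i. scale (1 / fact i) (e i w)"])
        (use E in \<open>simp add: E_eq[OF M]\<close>)
    then show ?thesis by (rule V.subspace_scale_cancel[OF N]) simp
  qed (use M V.subspace_0[OF N] in simp)
qed

lemma act_eq: "act p w = (\<Sum>i\<le>degree p. scale (coeff p i) (e i w))"
proof -
  have "act p w = act (\<Sum>i\<le>degree p. smult (coeff p i) (monom 1 i)) w"
    by (simp add: smult_monom poly_as_sum_of_monoms)
  then show ?thesis
    by (simp only: linear_sum[OF W.linear_act_left] linear_scale[OF W.linear_act_left] e_def)
qed

lemma lie_submoduleI:
  assumes "V.subspace N" "\<And>i w. w \<in> N \<Longrightarrow> e i w \<in> N"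
  shows "lie_submodule scale act N"
proof -
  have "act p w \<in> N" if "w \<in> N" for p w
    by (subst act_eq) (intro V.subspace_sum V.subspace_scale assms that)
  then show ?thesis using assms(1) by (simp add: lie_submodule_def)
qed

lemma lie_submoduleI_E:
  assumes "V.subspace N" "\<And>k w. w \<in> N \<Longrightarrow> E k w \<in> N"
  shows "lie_submodule scale act N"
  by (rule lie_submoduleI[OF assms(1)]) (rule e_mem_of_E[OF assms])

text \<open>In a simple module of highest weight \<open>b' \<noteq> 0\<close> this is one more than the degree in \<open>e 0\<close>
(\<open>top_index_e0_poly\<close>). In general it replaces the degree in arguments about leading terms.\<close>

definition top_index :: "nat \<Rightarrow> 'w \<Rightarrow> bool" where
  "top_index r w \<longleftrightarrow> e r w \<noteq> 0 \<and> (\<forall>i>r. e i w = 0)"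

lemma top_index_unique: "top_index r w \<Longrightarrow> top_index s w \<Longrightarrow> r = s"
  unfolding top_index_def by (metis linorder_neqE_nat)

text \<open>Since \<open>[e\<^sub>i, e\<^sub>0] = - i e\<^sub>i\<^sub>-\<^sub>1\<close>, the vector \<open>e\<^sub>r\<^sub>+\<^sub>1 e\<^sub>0 w\<close> is \<open>- (r + 1) e\<^sub>r w\<close>.\<close>

lemma top_index_e0:
  assumes "top_index r w"
  shows "top_index (Suc r) (e 0 w - scale c w)"
  using assms by (auto simp: top_index_def linear_diff[OF e_linear] linear_scale[OF e_linear]
      e_e0 linear_zero[OF e_linear] simp del: of_nat_Suc)

lemma polynomial_seq_E: "V.polynomial_seq (\<lambda>k. E (s + k * d) w)"
proof -
  obtain M where "\<And>i. i \<ge> M \<Longrightarrow> e i w = 0" using e_bound by blast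
  then have "E (s + k * d) w =
      (\<Sum>i<M. scale ((of_int s + of_int k * of_int d) ^ i) (scale (1 / fact i) (e i w)))" for k
    by (subst E_eq[of M]) auto
  then show ?thesis
    by (auto intro!: V.polynomial_seq_sum V.polynomial_seq_affine_power V.polynomial_seq_const
        simp del: V.scale_scale)
qed

lemma top_diff_E:
  assumes "\<And>i. i > r \<Longrightarrow> e i w = 0"
  shows "V.top_diff r (scale (of_int d ^ r) (e r w)) (\<lambda>k. E (s + k * d) w)"
proof -
  let ?g = "\<lambda>i k. scale ((of_int s + of_int k * of_int d) ^ i) (scale (1 / fact i) (e i w))"
  have 1: "V.top_diff i (scale (of_int d ^ i) (e i w)) (?g i)" for i
    using V.top_diff_affine_power[of i "of_int d" "scale (1 / fact i) (e i w)" "of_int s"] by simp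
  have "V.top_diff r (\<Sum>i<r. 0) (\<lambda>k. \<Sum>i<r. ?g i k)"
    by (rule V.top_diff_sum) (auto intro: V.top_diff_less[OF 1] simp del: V.scale_scale)
  from V.top_diff_add[OF this 1[of r]]
  have "V.top_diff r (scale (of_int d ^ r) (e r w)) (\<lambda>k. \<Sum>i<Suc r. ?g i k)" by simp
  moreover have "E (s + k * d) w = (\<Sum>i<Suc r. ?g i k)" for k
    by (subst E_eq[of "Suc r"]) (use assms in auto)
  ultimately show ?thesis by simp
qed

definition e0_poly :: "'w \<Rightarrow> complex poly \<Rightarrow> 'w" where
  "e0_poly w p = fold_coeffs (\<lambda>c v. scale c w + e 0 v) p 0"

lemma e0_poly_0 [simp]: "e0_poly w 0 = 0"
  by (simp add: e0_poly_def)

lemma e0_poly_pCons [simp]: "e0_poly w (pCons c p) = scale c w + e 0 (e0_poly w p)"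
  by (cases "c = 0 \<and> p = 0") (auto simp: e0_poly_def linear_zero[OF e_linear])

lemma e0_poly_linear: "Vector_Spaces.linear smult scale (e0_poly w)"
proof (rule linearI[OF W.L.vector_space_axioms V.vector_space_axioms])
  show "e0_poly w (p + q) = e0_poly w p + e0_poly w q" for p q
    by (induction p q rule: poly_induct2)
      (simp_all add: linear_add[OF e_linear] V.scale_left_distrib)
  show "e0_poly w (smult c p) = scale c (e0_poly w p)" for c p
    by (induction p) (simp_all add: linear_scale[OF e_linear] V.scale_right_distrib)
qed

text \<open>From \<open>E\<^sub>k e\<^sub>0 = (e\<^sub>0 - k) E\<^sub>k\<close> one gets \<open>E\<^sub>k p(e\<^sub>0) w = p(e\<^sub>0 - k) E\<^sub>k w\<close>, and
\<open>E\<^sub>k w = (e\<^sub>0 + k b') w\<close>. The weight \<open>b' = 0\<close> is used in \<open>e_pos_kernel\<close>.\<close>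

lemma e0_poly_E:
  assumes "e 1 w = scale b' w" "\<And>i. i \<ge> 2 \<Longrightarrow> e i w = 0"
  shows "E k (e0_poly w p) =
    e0_poly w ([:of_int k * b', 1:] * pcompose p [:- of_int k, 1:])"
proof (induction p)
  case 0
  then show ?case by (simp add: linear_zero[OF E_linear])
next
  case (pCons c p)
  have "E k w = e0_poly w [:of_int k * b', 1:]"
    using assms by (subst E_eq[of 2]) (auto simp: numeral_2_eq_2 linear_zero[OF e_linear])
  moreover have "e 0 (e0_poly w q) - scale (of_int k) (e0_poly w q) = e0_poly w ([:- of_int k, 1:] * q)" for q
    by (simp add: linear_diff[OF e0_poly_linear] linear_scale[OF e0_poly_linear])
  ultimately have "E k (e0_poly w (pCons c p)) =
      scale c (e0_poly w [:of_int k * b', 1:])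
      + e0_poly w ([:- of_int k, 1:] * ([:of_int k * b', 1:] * pcompose p [:- of_int k, 1:]))"
    by (simp add: linear_add[OF E_linear] linear_scale[OF E_linear] E_e0 pCons.IH
        del: e0_poly_pCons) (simp add: linear_add[OF E_linear] linear_scale[OF E_linear] E_e0 pCons.IH)
  also have "\<dots> = e0_poly w (smult c [:of_int k * b', 1:]
      + [:- of_int k, 1:] * ([:of_int k * b', 1:] * pcompose p [:- of_int k, 1:]))"
    by (simp only: linear_add[OF e0_poly_linear] linear_scale[OF e0_poly_linear])
  also have "smult c [:of_int k * b', 1:]
      + [:- of_int k, 1:] * ([:of_int k * b', 1:] * pcompose p [:- of_int k, 1:])
    = [:of_int k * b', 1:] * pcompose (pCons c p) [:- of_int k, 1:]"
    unfolding pcompose_pCons by (simp add: algebra_simps)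
  finally show ?case .
qed

lemma e0_poly_submodule:
  assumes "e 1 w = scale b' w" "\<And>i. i \<ge> 2 \<Longrightarrow> e i w = 0"
  shows "lie_submodule scale act (range (e0_poly w))"
proof (rule lie_submoduleI_E)
  show "V.subspace (range (e0_poly w))"
    by (rule V.subspaceI)
      (auto simp flip: linear_add[OF e0_poly_linear] linear_scale[OF e0_poly_linear]
        intro: range_eqI[of _ _ 0])
qed (auto simp: e0_poly_E[OF assms])

end

locale simple_witt_O_module = witt_O_module scale act
  for scale :: "complex \<Rightarrow> 'w::ab_group_add \<Rightarrow> 'w" and act :: "complex poly \<Rightarrow> 'w \<Rightarrow> 'w" +
  assumes simple: "simple_witt_module scale act" and nontrivial: "\<not> trivial_lie_module act"
begin

lemma submodule_UNIV: "lie_submodule scale act M \<Longrightarrow> w \<in> M \<Longrightarrow> w \<noteq> 0 \<Longrightarrow> M = UNIV"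
  using simple unfolding simple_lie_module_def simple_lie_submodule_def by blast

lemma ex_nonzero: "\<exists>w::'w. w \<noteq> 0"
  using simple unfolding simple_lie_module_def simple_lie_submodule_def by blast

lemma ex_e_nonzero: "\<exists>i w. e i w \<noteq> 0"
proof (rule ccontr)
  assume "\<nexists>i w. e i w \<noteq> 0"
  then have "act p w = 0" for p w by (subst act_eq) simp
  then show False using nontrivial by (simp add: trivial_lie_module_def)
qed

text \<open>A vector \<open>w\<close> killed by all \<open>e\<^sub>i\<close> with \<open>i \<ge> 1\<close> would generate a module of highest weight \<open>0\<close>, in
which the vectors \<open>e\<^sub>0 q(e\<^sub>0) w\<close> form a submodule. If it vanishes, \<open>W\<close> is spanned by \<open>w\<close> and
trivial. If it is everything, then \<open>w = e\<^sub>0 q(e\<^sub>0) w\<close>, a relation between eigenvectors of \<open>e\<^sub>1\<close>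
with distinct eigenvalues \<open>0, -1, -2, \<dots>\<close> in which \<open>w\<close> occurs.\<close>

lemma e_pos_kernel:
  assumes w: "\<And>i. i \<ge> 1 \<Longrightarrow> e i w = 0"
  shows "w = 0"
proof (rule ccontr)
  assume "w \<noteq> 0"
  have hw: "e 1 w = scale 0 w" "\<And>i. i \<ge> 2 \<Longrightarrow> e i w = 0" using w by auto
  note L = linear_add[OF e0_poly_linear] linear_scale[OF e0_poly_linear]
  let ?Y = "range (\<lambda>q. e0_poly w ([:0, 1:] * q))"
  have Y: "lie_submodule scale act ?Y"
  proof (rule lie_submoduleI_E)
    show "V.subspace ?Y"
    proof (rule V.subspaceI)
      show "0 \<in> ?Y" by (rule range_eqI[of _ _ 0]) simp
      show "x + y \<in> ?Y" if "x \<in> ?Y" "y \<in> ?Y" for x y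
        using that by (auto simp flip: L distrib_left simp del: mult_pCons_left)
      show "scale c x \<in> ?Y" if "x \<in> ?Y" for c x
        using that by (auto simp flip: L mult_smult_right simp del: mult_pCons_left)
    qed
    show "E k v \<in> ?Y" if "v \<in> ?Y" for k v
      using that by (auto simp: e0_poly_E[OF hw] simp del: mult_pCons_left e0_poly_pCons)
  qed
  show False
  proof (cases "e 0 w = 0")
    case True
    have e: "e i w = 0" for i using True w[of i] by (cases i) auto
    have "lie_submodule scale act (range (\<lambda>c. scale c w))"
    proof (rule lie_submoduleI)
      show "V.subspace (range (\<lambda>c. scale c w))"
        by (rule V.subspaceI)
          (auto simp flip: V.scale_left_distrib intro: range_eqI[of _ _ 0])
    qed (auto simp: linear_scale[OF e_linear] e intro: range_eqI[of _ _ 0])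
    then have "range (\<lambda>c. scale c w) = UNIV"
      by (rule submodule_UNIV[OF _ _ \<open>w \<noteq> 0\<close>]) (rule range_eqI[of _ _ 1], simp)
    then have "e i v = 0" for i v
      by (metis (no_types, lifting) e linear_scale[OF e_linear] V.scale_zero_right rangeE UNIV_I)
    then show False using ex_e_nonzero by blast
  next
    case False
    have "?Y = UNIV"
      by (rule submodule_UNIV[OF Y _ False])
        (rule range_eqI[of _ _ 1], simp add: linear_zero[OF e_linear])
    then obtain q where q: "w = e0_poly w ([:0, 1:] * q)" by blast
    define p where "p = pCons (- 1) q"
    let ?v = "\<lambda>i. scale (coeff p i) (e0_poly w (monom 1 i))"
    have "e0_poly w p = 0" using q by (simp add: p_def)
    moreover have "e0_poly w p = (\<Sum>i\<le>degree p. ?v i)"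
      by (simp only: linear_sum[OF e0_poly_linear, symmetric] linear_scale[OF e0_poly_linear, symmetric]
          smult_monom mult_1_right poly_as_sum_of_monoms)
    ultimately have "(\<Sum>i\<le>degree p. ?v i) \<in> {0}" by simp
    moreover have "e 1 (e0_poly w (monom 1 i)) = scale (- of_nat i) (e0_poly w (monom 1 i))" for i
    proof (induction i)
      case 0
      then show ?case using w[of 1] by (simp add: linear_zero[OF e_linear] monom_0)
    next
      case (Suc i)
      then show ?case
        using e_e0[of 1 "e0_poly w (monom 1 i)"]
        by (simp add: monom_Suc linear_scale[OF e_linear, where c = "- of_nat i", simplified]
            V.scale_left_diff_distrib V.scale_left_distrib)
    qed
    moreover have "inj_on (\<lambda>i. - of_nat i :: complex) {..degree p}"
      by (auto simp: inj_on_def)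
    ultimately have "?v 0 \<in> {0}"
      by (intro V.subspace_eigenvectors[of "{0}" "e 1" "{..degree p}" "\<lambda>i. - of_nat i" ?v 0])
        (auto simp: linear_scale[OF e_linear] mult.commute e_linear linear_zero[OF e_linear])
    then show False using \<open>w \<noteq> 0\<close> by (simp add: p_def monom_0 linear_zero[OF e_linear])
  qed
qed

lemma ex_top_index:
  assumes "w \<noteq> 0"
  shows "\<exists>r\<ge>1. top_index r w"
proof -
  obtain M where M: "\<And>i. i \<ge> M \<Longrightarrow> e i w = 0" using e_bound by blast
  let ?I = "{i. e i w \<noteq> 0}"
  have fin: "finite ?I" by (rule finite_subset[of _ "{..<M}"]) (use M not_less in auto)
  obtain i where i: "i \<ge> 1" "e i w \<noteq> 0" using e_pos_kernel assms by blast
  have "top_index (Max ?I) w"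
    unfolding top_index_def using Max_in[OF fin] Max_ge[OF fin] i by fastforce
  moreover have "Max ?I \<ge> 1" using Max_ge[OF fin, of i] i by simp
  ultimately show ?thesis by blast
qed

text \<open>A vector whose top index is minimal cannot be of the form \<open>(e\<^sub>0 - c) v\<close>, since the top index of
\<open>v\<close> would be smaller by one.\<close>

lemma e0_not_surj: "\<exists>w. \<forall>c. w \<notin> range (\<lambda>v. e 0 v - scale c v)"
proof -
  define P where "P r \<longleftrightarrow> (\<exists>w. w \<noteq> 0 \<and> top_index r w)" for r
  have "\<exists>r. P r" using ex_nonzero ex_top_index unfolding P_def by blast
  define r where "r = (LEAST r. P r)"
  have "P r" unfolding r_def using \<open>\<exists>r. P r\<close> by (rule LeastI_ex)
  then obtain w where w: "w \<noteq> 0" "top_index r w" by (auto simp: P_def)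
  have "w \<noteq> e 0 v - scale c v" for c v
  proof
    assume eq: "w = e 0 v - scale c v"
    then have "v \<noteq> 0" using w(1) by (auto simp: linear_zero[OF e_linear])
    then obtain s where s: "top_index s v" using ex_top_index by blast
    then have "r \<le> s" unfolding r_def using \<open>v \<noteq> 0\<close> by (intro Least_le) (auto simp: P_def)
    moreover have "r = Suc s"
      using top_index_unique[OF w(2)] top_index_e0[OF s, of c] by (simp add: eq)
    ultimately show False by simp
  qed
  then show ?thesis by blast
qed

end

context witt_O_module
begin

text \<open>Coefficient extraction for expressions that are affine in \<open>k\<close> apart from one occurrence of
\<open>E\<^sub>k\<close>. The factor \<open>1/i!\<close> is \<open>1\<close> in degrees \<open>0\<close> and \<open>1\<close>, where the affine part contributes.\<close>

lemma E_affine_coeff: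
  assumes N: "V.subspace N" and T: "Vector_Spaces.linear scale scale T"
    and mem: "\<And>k. x + scale (of_int k) y + T (E k w) \<in> N"
  shows "x + T (e 0 w) \<in> N" "y + T (e 1 w) \<in> N" "i \<ge> 2 \<Longrightarrow> T (e i w) \<in> N"
proof -
  obtain M0 where M0: "\<And>i. i \<ge> M0 \<Longrightarrow> e i w = 0" using e_bound by blast
  define v where "v i = (if i = 0 then x else if i = 1 then y else 0) + scale (1 / fact i) (T (e i w))"
    for i :: nat
  have v: "v i \<in> N" for i
  proof (rule V.subspace_poly_coeff[OF N])
    \<comment> \<open>The bound exceeds \<open>1\<close>, so that the sum contains the terms with \<open>x\<close> and \<open>y\<close>.\<close>
    let ?M = "Suc (max M0 (max 2 i))"
    let ?h = "\<lambda>k i. scale (of_int k ^ i) (if i = 0 then x else if i = 1 then y else 0)"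
    show "i < ?M" by simp
    fix k :: int
    have "(\<Sum>i<?M. ?h k i) = (\<Sum>i\<in>{0, 1}. ?h k i)"
      by (rule sum.mono_neutral_right) auto
    moreover have "T (E k w) = (\<Sum>i<?M. scale (of_int k ^ i) (scale (1 / fact i) (T (e i w))))"
      by (subst E_eq[of ?M]) (auto simp: M0 linear_sum[OF T] linear_scale[OF T] simp del: sum.lessThan_Suc)
    moreover have "(\<Sum>i\<in>{0, 1}. ?h k i) = x + scale (of_int k) y" by simp
    ultimately have "(\<Sum>i<?M. scale (of_int k ^ i) (v i)) = x + scale (of_int k) y + T (E k w)"
      by (simp only: v_def V.scale_right_distrib sum.distrib)
    then show "(\<Sum>i<?M. scale (of_int k ^ i) (v i)) \<in> N" using mem by simp
  qed
  show "x + T (e 0 w) \<in> N" "y + T (e 1 w) \<in> N" using v[of 0] v[of 1] by (simp_all add: v_def)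
  show "T (e i w) \<in> N" if "i \<ge> 2"
    using v[of i] that by (simp add: v_def V.subspace_scale_cancel[OF N, of "1 / fact i"])
qed

lemma polynomial_seq_E_E: "V.polynomial_seq (\<lambda>k. E (s - k) (E k w))"
proof -
  obtain M where M: "\<And>i. i \<ge> M \<Longrightarrow> e i w = 0" using e_bound by blast
  have "E (s - k) (E k w) =
      (\<Sum>i<M. scale ((0 + of_int k * 1) ^ i) (scale (1 / fact i) (E (s + k * (- 1)) (e i w))))" for k
    by (subst E_eq[of M]) (auto simp: M linear_sum[OF E_linear] linear_scale[OF E_linear])
  then show ?thesis
    by (simp only:)
      (intro V.polynomial_seq_sum V.polynomial_seq_affine_power V.polynomial_seq_scale polynomial_seq_E)
qed

end

section \<open>Graded structure of the loop module\<close>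

locale loop_module = simple_witt_O_module scale act
  for scale :: "complex \<Rightarrow> 'w::ab_group_add \<Rightarrow> 'w" and act :: "complex poly \<Rightarrow> 'w \<Rightarrow> 'w" +
  fixes lam a b :: complex
  assumes lam: "lam \<noteq> 0"
begin

abbreviation "C \<equiv> loop_coeff scale act lam a b"
abbreviation "L \<equiv> loop_act scale act lam a b"

sublocale Q: vector_space_char_0 "pm_scale scale :: complex \<Rightarrow> (int \<Rightarrow>\<^sub>0 'w) \<Rightarrow> _"
  by (rule vector_space_char_0.intro[OF vector_space_loop[OF O]])

sublocale P: lie_module vir_scale vir_bracket "pm_scale scale" L
  by (rule loop_lie_module[OF O lam])

abbreviation loop_submodule :: "(int \<Rightarrow>\<^sub>0 'w) set \<Rightarrow> bool" where
  "loop_submodule \<equiv> lie_submodule (pm_scale scale) L"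

lemmas L_d = loop_act_d[OF O, of lam a b]
lemmas lookup_scale = lookup_pm_scale[where s = scale, OF V.scale_zero_right]
lemmas scale_single = pm_scale_single[where s = scale, OF V.scale_zero_right]

lemma C_eq: "C k j w = scale (lam powi k) (E k w) - e 0 w + scale (a + of_int k * b + of_int j) w"
  using act_witt_d[of 0] by (simp add: loop_coeff_def)

lemma C_0: "C 0 j w = scale (a + of_int j) w"
  by (simp add: C_eq E_0)

lemma sum_single: "(\<Sum>j\<in>Poly_Mapping.keys f. Poly_Mapping.single j (Poly_Mapping.lookup f j)) = f"
  for f :: "int \<Rightarrow>\<^sub>0 'w"
  by (rule poly_mapping_eqI) (auto simp: lookup_sum lookup_single when_def in_keys_iff)

lemma graded_submodule:
  assumes S: "\<And>j. V.subspace (S j)" and C: "\<And>k j w. w \<in> S j \<Longrightarrow> C k j w \<in> S (k + j)"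
  shows "loop_submodule {f. \<forall>j. Poly_Mapping.lookup f j \<in> S j}"
proof -
  let ?N = "{f. \<forall>j. Poly_Mapping.lookup f j \<in> S j}"
  have N: "Q.subspace ?N"
    by (rule Q.subspaceI)
      (auto simp: lookup_add lookup_scale intro: V.subspace_0[OF S] V.subspace_add[OF S] V.subspace_scale[OF S])
  have single: "Poly_Mapping.single j w \<in> ?N" if "w \<in> S j" for j w
    using that by (simp add: lookup_single when_def V.subspace_0[OF S])
  have "loop_basis_act scale act lam a b p f \<in> ?N" if "f \<in> ?N" for p f
  proof (cases p)
    case (D k)
    show ?thesis
      unfolding D loop_basis_act.simps by (intro Q.subspace_sum[OF N] single C) (use that in simp)
  qed (simp add: V.subspace_0[OF S])
  then have "L x f \<in> ?N" if "f \<in> ?N" for x f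
    unfolding loop_act_def linear_ext_def
    by (intro Q.subspace_sum[OF N] Q.subspace_scale[OF N]) (use that in blast)
  with N show ?thesis unfolding lie_submodule_def by blast
qed

text \<open>The part of the action of \<open>d\<^sub>l\<close> into degree \<open>m\<close> that is free of \<open>lam\<close>, written in terms of the
target degree because the computations fix that degree.\<close>

definition A :: "int \<Rightarrow> int \<Rightarrow> 'w \<Rightarrow> 'w" where
  "A m l v = scale (a + of_int m - of_int l * (1 - b)) v - e 0 v"

lemma A_linear: "Vector_Spaces.linear scale scale (A m l)"
  by (rule linearI[OF V.vector_space_axioms V.vector_space_axioms])
    (simp_all add: A_def linear_add[OF e_linear] linear_scale[OF e_linear] V.scale_right_distrib
      V.scale_right_diff_distrib mult.commute)

text \<open>Moving \<open>E l\<close> past \<open>e 0\<close> shifts \<open>e 0\<close> by \<open>l\<close>; expressed through the target degree \<open>m\<close>, the mixed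
terms become symmetric under exchange of \<open>k\<close> and \<open>l\<close>.\<close>

lemma C_compose:
  assumes "m = j + k + l"
  shows "C l (k + j) (C k j w) =
    scale (lam powi (k + l)) (E l (E k w)) + scale (lam powi l) (A m k (E l w))
    + scale (lam powi k) (A m l (E k w)) + A m l (A m k w - scale (of_int l) w)"
proof -
  have 1: "C l (k + j) v = scale (lam powi l) (E l v) + A m l v" for v
    unfolding C_eq A_def assms by (simp add: algebra_simps)
  have 2: "C k j w = scale (lam powi k) (E k w) + A m k w - scale (of_int l) w"
    unfolding C_eq A_def assms by (simp add: V.scale_left_distrib V.scale_left_diff_distrib algebra_simps)
  have 3: "E l (A m k w) = A m k (E l w) + scale (of_int l) (E l w)"
    by (simp add: A_def linear_diff[OF E_linear] linear_scale[OF E_linear] E_e0)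
  have 4: "lam powi (k + l) = lam powi l * lam powi k"
    using lam by (simp add: power_int_add)
  have "E l (C k j w) = scale (lam powi k) (E l (E k w)) + A m k (E l w)"
    unfolding 2 by (simp add: linear_add[OF E_linear] linear_diff[OF E_linear] linear_scale[OF E_linear] 3)
  moreover have "A m l (C k j w) = scale (lam powi k) (A m l (E k w)) + A m l (A m k w - scale (of_int l) w)"
    unfolding 2 by (simp add: linear_add[OF A_linear] linear_diff[OF A_linear] linear_scale[OF A_linear])
  ultimately show ?thesis
    unfolding 1 by (simp add: 4 V.scale_right_distrib algebra_simps)
qed

lemma polynomial_seq_A:
  assumes "V.polynomial_seq g"
  shows "V.polynomial_seq (\<lambda>k. A m k (g k))" "V.polynomial_seq (\<lambda>k. A m (s - k) (g k))"
proof -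
  have "A m k (g k) = scale (a + of_int m + of_int k * (b - 1)) (g k) - e 0 (g k)"
    "A m (s - k) (g k) = scale (a + of_int m - of_int s * (1 - b) + of_int k * (1 - b)) (g k) - e 0 (g k)" for k
    by (simp_all add: A_def algebra_simps)
  then show "V.polynomial_seq (\<lambda>k. A m k (g k))" "V.polynomial_seq (\<lambda>k. A m (s - k) (g k))"
    by (auto intro!: V.polynomial_seq_diff V.polynomial_seq_affine
        V.polynomial_seq_linear[OF e_linear] assms)
qed

lemma polynomial_seq_E_simple: "V.polynomial_seq (\<lambda>k. E k w)" "V.polynomial_seq (\<lambda>k. E (s - k) w)"
  using polynomial_seq_E[of 0 1 w] polynomial_seq_E[of s "-1" w] by simp_all

lemma top_diff_A:
  assumes "V.top_diff r u g"
  shows "V.top_diff (Suc r) (scale (of_nat (Suc r) * (b - 1)) u) (\<lambda>k. A m k (g k))"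
    "V.top_diff (Suc r) (scale (of_nat (Suc r) * (1 - b)) u) (\<lambda>k. A m (s - k) (g k))"
proof -
  have *: "A m k (g k) = scale (a + of_int m + of_int k * (b - 1)) (g k) + scale (- 1) (e 0 (g k))"
    "A m (s - k) (g k) = scale (a + of_int m - of_int s * (1 - b) + of_int k * (1 - b)) (g k)
      + scale (- 1) (e 0 (g k))" for k
    by (simp_all add: A_def algebra_simps)
  have 0: "V.top_diff (Suc r) 0 (\<lambda>k. scale (- 1) (e 0 (g k)))"
    by (rule V.top_diff_Suc[OF V.top_diff_scale[OF V.top_diff_linear[OF e_linear assms]]])
  show "V.top_diff (Suc r) (scale (of_nat (Suc r) * (b - 1)) u) (\<lambda>k. A m k (g k))"
    "V.top_diff (Suc r) (scale (of_nat (Suc r) * (1 - b)) u) (\<lambda>k. A m (s - k) (g k))"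
    using V.top_diff_add[OF V.top_diff_affine[OF assms, of "b - 1" "a + of_int m"] 0]
      V.top_diff_add[OF V.top_diff_affine[OF assms, of "1 - b" "a + of_int m - of_int s * (1 - b)"] 0]
    unfolding * add_0_right by this+
qed

definition component :: "(int \<Rightarrow>\<^sub>0 'w) set \<Rightarrow> int \<Rightarrow> 'w set" where
  "component N j = {w. Poly_Mapping.single j w \<in> N}"

definition common :: "(int \<Rightarrow>\<^sub>0 'w) set \<Rightarrow> 'w set" where
  "common N = {w. \<forall>j. w \<in> component N j}"

text \<open>Only the parity of \<open>\<sigma>\<close> matters. An integer index avoids reducing shifted degrees modulo \<open>2\<close>.\<close>

definition half_common :: "(int \<Rightarrow>\<^sub>0 'w) set \<Rightarrow> int \<Rightarrow> 'w set" where
  "half_common N \<sigma> = {w. \<forall>j. even (j - \<sigma>) \<longrightarrow> w \<in> component N j}"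

context
  fixes N assumes N: "loop_submodule N"
begin

lemma submodule_subspace: "Q.subspace N"
  using N by (simp add: lie_submodule_def)

lemma component_subspace: "V.subspace (component N j)"
  by (rule V.subspaceI)
    (auto simp: component_def single_add scale_single[symmetric]
      intro: Q.subspace_0[OF submodule_subspace] Q.subspace_add[OF submodule_subspace]
        Q.subspace_scale[OF submodule_subspace])

lemma component_C: "w \<in> component N j \<Longrightarrow> C k j w \<in> component N (k + j)"
  using N unfolding component_def lie_submodule_def mem_Collect_eq L_d[symmetric] by blast

text \<open>The homogeneous parts of \<open>f\<close> are eigenvectors of \<open>d\<^sub>0\<close> with distinct eigenvalues \<open>a + j\<close>.\<close>

lemma lookup_mem_component:
  assumes "f \<in> N"
  shows "Poly_Mapping.lookup f j \<in> component N j"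
proof (cases "j \<in> Poly_Mapping.keys f")
  case True
  have "Poly_Mapping.single j (Poly_Mapping.lookup f j) \<in> N"
  proof (rule Q.subspace_eigenvectors[OF submodule_subspace P.linear_act_right[of "vir_d 0"],
        where v = "\<lambda>i. Poly_Mapping.single i (Poly_Mapping.lookup f i)" and c = "\<lambda>i. a + of_int i"])
    show "L (vir_d 0) x \<in> N" if "x \<in> N" for x
      using N that by (simp add: lie_submodule_def)
    show "L (vir_d 0) (Poly_Mapping.single i (Poly_Mapping.lookup f i)) =
        pm_scale scale (a + of_int i) (Poly_Mapping.single i (Poly_Mapping.lookup f i))" for i
      by (simp add: L_d C_0 scale_single)
    show "inj_on (\<lambda>i. a + of_int i) (Poly_Mapping.keys f)" by (auto simp: inj_on_def)
    show "(\<Sum>i\<in>Poly_Mapping.keys f. Poly_Mapping.single i (Poly_Mapping.lookup f i)) \<in> N"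
      using assms by (simp add: sum_single)
  qed (use True in simp_all)
  then show ?thesis by (simp add: component_def)
next
  case False
  then show ?thesis using V.subspace_0[OF component_subspace] by (simp add: in_keys_iff)
qed

lemma memI_component:
  assumes "\<And>j. Poly_Mapping.lookup f j \<in> component N j"
  shows "f \<in> N"
  using Q.subspace_sum[OF submodule_subspace, of "Poly_Mapping.keys f"
      "\<lambda>j. Poly_Mapping.single j (Poly_Mapping.lookup f j)"] assms
  by (simp add: sum_single component_def)

lemma ex_component:
  assumes "N \<noteq> {0}"
  shows "\<exists>j w. w \<noteq> 0 \<and> w \<in> component N j"
proof -
  obtain f where f: "f \<in> N" "f \<noteq> 0"
    using assms Q.subspace_0[OF submodule_subspace] by blast
  then obtain j where "Poly_Mapping.lookup f j \<noteq> 0"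
    by (metis poly_mapping_eqI lookup_zero)
  then show ?thesis using lookup_mem_component[OF f(1)] by blast
qed

section \<open>Separating exponentials in products of two operators\<close>

text \<open>The composite \<open>d\<^sub>s\<^sub>-\<^sub>k d\<^sub>k\<close> applied to \<open>w\<close>, with \<open>s\<close> fixed. The summand \<open>P\<close> collects
\<open>lam\<^sup>s E\<^sub>s\<^sub>-\<^sub>k E\<^sub>k w\<close> and the terms free of \<open>E\<close>; only its polynomial nature matters.\<close>

lemma exp_poly_mem_component:
  assumes w: "w \<in> component N j"
  obtains P where "V.polynomial_seq P"
    "\<And>k. P k + scale (lam powi k) (A (j + s) (s - k) (E k w))
      + scale (inverse lam powi k) (scale (lam powi s) (A (j + s) k (E (s - k) w))) \<in> component N (j + s)"
proof
  let ?m = "j + s"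
  let ?P = "\<lambda>k. scale (lam powi s) (E (s - k) (E k w))
    + A ?m (s - k) (A ?m k w - scale (of_int s + of_int k * (- 1)) w)"
  show "V.polynomial_seq ?P"
    by (intro V.polynomial_seq_add V.polynomial_seq_scale polynomial_seq_E_E polynomial_seq_A
        V.polynomial_seq_diff V.polynomial_seq_affine V.polynomial_seq_const)
  fix k
  have "C (s - k) (k + j) (C k j w) \<in> component N (s - k + (k + j))"
    by (intro component_C w)
  moreover have "lam powi (s - k) = inverse lam powi k * lam powi s"
    using lam by (simp add: power_int_diff power_int_inverse field_simps)
  ultimately show "?P k + scale (lam powi k) (A ?m (s - k) (E k w))
      + scale (inverse lam powi k) (scale (lam powi s) (A ?m k (E (s - k) w))) \<in> component N ?m"
    using C_compose[of ?m j k "s - k" w] by (simp add: algebra_simps)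
qed

lemma generic_mem_component:
  assumes "lam \<noteq> 1" "lam \<noteq> - 1" "w \<in> component N j"
  shows "A (j + s) (s - k) (E k w) \<in> component N (j + s)"
proof -
  obtain P where P: "V.polynomial_seq P"
    "\<And>k. P k + scale (lam powi k) (A (j + s) (s - k) (E k w))
      + scale (inverse lam powi k) (scale (lam powi s) (A (j + s) k (E (s - k) w))) \<in> component N (j + s)"
    by (rule exp_poly_mem_component[OF assms(3)]) blast
  from P(1) obtain n where n: "V.top_diff n 0 P" by (auto simp: V.polynomial_seq_def)
  show ?thesis
    by (rule V.exp_polynomial_separate3[OF component_subspace assms(1,2) lam n _ _ P(2)])
      (intro polynomial_seq_A V.polynomial_seq_scale polynomial_seq_E_simple)+
qed

lemma minus_one_mem_component:
  assumes "lam = - 1" "w \<in> component N j"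
  shows "A (j + s) (s - k) (E k w) + scale ((- 1) powi s) (A (j + s) k (E (s - k) w))
    \<in> component N (j + s)"
proof -
  obtain P where P: "V.polynomial_seq P"
    "\<And>k. P k + scale (lam powi k) (A (j + s) (s - k) (E k w))
      + scale (inverse lam powi k) (scale (lam powi s) (A (j + s) k (E (s - k) w))) \<in> component N (j + s)"
    by (rule exp_poly_mem_component[OF assms(2)]) blast
  from P(1) obtain n where n: "V.top_diff n 0 P" by (auto simp: V.polynomial_seq_def)
  let ?Q = "\<lambda>k. A (j + s) (s - k) (E k w) + scale ((- 1) powi s) (A (j + s) k (E (s - k) w))"
  show ?thesis
  proof (rule V.exp_polynomial_separate2[OF component_subspace _ _ n, of "- 1" ?Q])
    show "V.polynomial_seq ?Q"
      by (intro V.polynomial_seq_add polynomial_seq_A V.polynomial_seq_scale polynomial_seq_E_simple)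
    show "P k + scale ((- 1) powi k) (?Q k) \<in> component N (j + s)" for k
      using P(2)[of k] assms(1) by (simp add: V.scale_right_distrib add.assoc)
  qed simp_all
qed

lemma all_components_UNIV:
  assumes "\<And>j. component N j = UNIV"
  shows "N = UNIV"
  using assms memI_component by blast

lemma common_subspace: "V.subspace (common N)"
  by (rule V.subspaceI)
    (auto simp: common_def V.subspace_0[OF component_subspace] V.subspace_add[OF component_subspace]
      V.subspace_scale[OF component_subspace])

lemma common_UNIV:
  assumes "lie_submodule scale act (common N)" "w \<in> common N" "w \<noteq> 0"
  shows "N = UNIV"
  using submodule_UNIV[OF assms] by (intro all_components_UNIV) (auto simp: common_def)

section \<open>Submodules for lam different from 1 and -1\<close>

lemma generic_submodule_UNIV:
  assumes "lam \<noteq> 1" "lam \<noteq> - 1" "b \<noteq> 1" "N \<noteq> {0}"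
  shows "N = UNIV"
proof -
  obtain j w where w: "w \<noteq> 0" "w \<in> component N j" using ex_component[OF assms(4)] by blast
  obtain r where r: "top_index r w" using ex_top_index[OF w(1)] by blast
  have top: "V.top_diff r (e r w) (\<lambda>k. E k w)"
    using top_diff_E[of r w 1 0] r by (simp add: top_index_def)
  show ?thesis
  proof (rule common_UNIV)
    show "e r w \<noteq> 0" using r by (simp add: top_index_def)
    show "e r w \<in> common N"
      unfolding common_def
    proof safe
      fix m
      \<comment> \<open>Leading term of \<open>A m (m - j - k) (E k w)\<close> in \<open>k\<close>; the target degree \<open>m\<close> is arbitrary.\<close>
      have "scale (of_nat (Suc r) * (1 - b)) (e r w) \<in> component N m"
        by (rule V.top_diff_mem[OF component_subspace top_diff_A(2)[OF top, of m "m - j"]])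
          (use generic_mem_component[OF assms(1,2) w(2), of "m - j"] in simp)
      then show "e r w \<in> component N m"
        by (rule V.subspace_scale_cancel[OF component_subspace])
          (use assms(3) in \<open>simp del: of_nat_Suc\<close>)
    qed
    show "lie_submodule scale act (common N)"
    proof (rule lie_submoduleI_E[OF common_subspace])
      fix k v assume v: "v \<in> common N"
      have *: "A m l (E k v) \<in> component N m" for m l
        using generic_mem_component[OF assms(1,2), of v "m - (k + l)" "k + l" k] v
        by (simp add: common_def)
      \<comment> \<open>For a common vector \<open>l\<close> can vary while the target degree \<open>m\<close> stays fixed.\<close>
      have "A m 0 (E k v) - A m 1 (E k v) \<in> component N m" for m
        by (intro V.subspace_diff[OF component_subspace] *)
      then have "scale (1 - b) (E k v) \<in> component N m" for m
        by (simp add: A_def flip: V.scale_left_diff_distrib)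
      then have "E k v \<in> component N m" for m
        by (rule V.subspace_scale_cancel[OF component_subspace]) (use assms(3) in simp)
      then show "E k v \<in> common N" by (simp add: common_def)
    qed
  qed
qed

section \<open>Submodules for lam = -1\<close>

text \<open>The leading coefficient of \<open>Q + R\<close> is \<open>e\<^sub>r w\<close> times a multiple of \<open>1 - (-1)\<^sup>s\<^sup>+\<^sup>r\<close>, so it
survives exactly when \<open>s\<close> and \<open>r\<close> have different parity.\<close>

lemma ex_half_common:
  assumes "lam = - 1" "b \<noteq> 1" "N \<noteq> {0}"
  shows "\<exists>\<sigma> w. w \<noteq> 0 \<and> w \<in> half_common N \<sigma>"
proof -
  obtain j w where w: "w \<noteq> 0" "w \<in> component N j" using ex_component[OF assms(3)] by blast
  obtain r where r: "top_index r w" using ex_top_index[OF w(1)] by blast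
  have top: "V.top_diff r (e r w) (\<lambda>k. E k w)"
    "V.top_diff r (scale ((- 1) ^ r) (e r w)) (\<lambda>k. E (s - k) w)" for s
    using top_diff_E[of r w 1 0] top_diff_E[of r w "-1" s] r by (simp_all add: top_index_def)
  have "e r w \<in> component N m" if "even (m - (j + int r + 1))" for m
  proof -
    have ev: "(- 1 :: complex) powi (m - j) * (- 1) ^ r = - 1"
      using that by (auto simp: power_int_minus_left uminus_power_if)
    have "scale (of_nat (Suc r) * (1 - b)) (e r w) + scale ((- 1) powi (m - j))
        (scale (of_nat (Suc r) * (b - 1)) (scale ((- 1) ^ r) (e r w))) \<in> component N m"
      by (rule V.top_diff_mem[OF component_subspace V.top_diff_add[OF top_diff_A(2)[OF top(1), of m "m - j"]
            V.top_diff_scale[OF top_diff_A(1)[OF top(2)[of "m - j"], of m]]]])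
        (use minus_one_mem_component[OF assms(1) w(2), of "m - j"] in simp)
    moreover have "(- 1) powi (m - j) * (of_nat (Suc r) * (b - 1) * (- 1) ^ r) = of_nat (Suc r) * (1 - b)"
      using arg_cong[OF ev, of "\<lambda>x. of_nat (Suc r) * (b - 1) * x"] by (simp add: algebra_simps)
    ultimately have "scale (of_nat (Suc r) * (1 - b) + of_nat (Suc r) * (1 - b)) (e r w) \<in> component N m"
      by (simp only: V.scale_scale V.scale_left_distrib)
    then show "e r w \<in> component N m"
      by (rule V.subspace_scale_cancel[OF component_subspace])
        (use assms(2) in \<open>simp del: of_nat_Suc\<close>)
  qed
  then have "e r w \<in> half_common N (j + int r + 1)" unfolding half_common_def by blast
  then show ?thesis using r by (auto simp: top_index_def)
qed

text \<open>The source degree \<open>m - k - l\<close> may be any integer congruent to \<open>\<sigma>\<close>, so \<open>k\<close> and \<open>l\<close> vary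
independently apart from a parity condition, which \<open>polynomial_seq_mem_parity\<close> removes. The
relations are the coefficients of \<open>l k\<^sup>i\<close> in the resulting polynomial in \<open>k\<close> and \<open>l\<close>.\<close>

lemma half_common_relations:
  assumes lam1: "lam = - 1" and b: "b \<noteq> 1" and w: "w \<in> half_common N \<sigma>"
  defines "\<epsilon> \<equiv> \<lambda>m. (- 1 :: complex) powi (m - \<sigma>)"
  shows "i \<ge> 2 \<Longrightarrow> e i w \<in> component N m"
    and "even (m - \<sigma>) \<Longrightarrow> e 1 w \<in> component N m"
    and "scale (\<epsilon> m) (A m 0 (e 1 w)) - scale (1 - b) (e 0 w) \<in> component N m"
proof -
  let ?N = "component N m"
  note N' = component_subspace[of m]
  have A0: "A m l v = A m 0 v + scale (of_int l) (scale (- (1 - b)) v)" for l v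
    by (simp add: A_def V.scale_left_diff_distrib algebra_simps)
  have G: "A m l (E k w) + scale (\<epsilon> m) (A m k (E l w)) \<in> ?N" for k l
  proof (rule V.polynomial_seq_mem_parity[OF N', where c = "l - (m - \<sigma>)" and k = k
        and g = "\<lambda>k. A m l (E k w) + scale (\<epsilon> m) (A m k (E l w))"])
    show "V.polynomial_seq (\<lambda>k. A m l (E k w) + scale (\<epsilon> m) (A m k (E l w)))"
      by (rule V.polynomial_seq_add[OF V.polynomial_seq_linear[OF A_linear polynomial_seq_E_simple(1)]
            V.polynomial_seq_scale[OF polynomial_seq_A(1)[OF V.polynomial_seq_const]]])
    fix k assume ev: "even (k + (l - (m - \<sigma>)))"
    have par: "even (m - (k + l) - \<sigma>)" "even (k + l) \<longleftrightarrow> even (m - \<sigma>)" using ev by presburger+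
    then have "w \<in> component N (m - (k + l))"
      using w unfolding half_common_def by blast
    moreover have "(- 1) powi (k + l) = \<epsilon> m"
      using par(2) unfolding \<epsilon>_def power_int_minus_left by simp
    ultimately show "A m l (E k w) + scale (\<epsilon> m) (A m k (E l w)) \<in> ?N"
      using minus_one_mem_component[OF lam1, of w "m - (k + l)" "k + l" k] by simp
  qed
  have T: "Vector_Spaces.linear scale scale (\<lambda>v. scale c (A m k v))"
    "Vector_Spaces.linear scale scale (scale c)" for c k
    by (rule linearI[OF V.vector_space_axioms V.vector_space_axioms];
        simp add: linear_add[OF A_linear] linear_scale[OF A_linear] V.scale_right_distrib mult.commute)+
  \<comment> \<open>The coefficient of \<open>l\<close>.\<close>
  have 1: "scale (- (1 - b)) (E k w) + scale (\<epsilon> m) (A m k (e 1 w)) \<in> ?N" for k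
  proof (rule E_affine_coeff(2)[OF N' T(1), of "A m 0 (E k w)"])
    show "A m 0 (E k w) + scale (of_int l) (scale (- (1 - b)) (E k w)) + scale (\<epsilon> m) (A m k (E l w)) \<in> ?N"
      for l using G[of l k] unfolding A0[of l "E k w"] .
  qed
  \<comment> \<open>The same vector, arranged by powers of \<open>k\<close>.\<close>
  have 2: "scale (\<epsilon> m) (A m 0 (e 1 w)) + scale (of_int k) (scale (- (1 - b) * \<epsilon> m) (e 1 w))
      + scale (- (1 - b)) (E k w) \<in> ?N" for k
    using 1[of k] unfolding A0[of k "e 1 w"] by (simp add: V.scale_right_distrib algebra_simps)
  note R = E_affine_coeff[OF N' T(2) 2]
  have cancel: "scale (- (1 - b)) v \<in> ?N \<Longrightarrow> v \<in> ?N" for v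
    by (rule V.subspace_scale_cancel[OF N']) (use b in auto)
  show "e i w \<in> ?N" if "i \<ge> 2" by (rule cancel[OF R(3)[OF that]])
  show "scale (\<epsilon> m) (A m 0 (e 1 w)) - scale (1 - b) (e 0 w) \<in> ?N"
    using R(1) by (simp add: V.scale_left_diff_distrib algebra_simps)
  show "e 1 w \<in> ?N" if "even (m - \<sigma>)"
  proof -
    have "\<epsilon> m = 1" using that by (simp add: \<epsilon>_def power_int_minus_left)
    then have "scale (2 * - (1 - b)) (e 1 w) \<in> ?N"
      using R(2) by (simp only: mult_1_right V.scale_left_distrib[symmetric] mult_2)
    then show ?thesis by (rule V.subspace_scale_cancel[OF N']) (use b in simp)
  qed
qed

text \<open>A common vector satisfies the relations for both parities. Adding the two versions of the last
relation, which differ in the sign of the term with \<open>e 1\<close>, isolates \<open>e 0\<close>.\<close>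

lemma minus_one_common_UNIV:
  assumes "lam = - 1" "b \<noteq> 1" "w \<in> common N" "w \<noteq> 0"
  shows "N = UNIV"
proof (rule common_UNIV[OF _ assms(3,4)])
  show "lie_submodule scale act (common N)"
  proof (rule lie_submoduleI[OF common_subspace])
    fix i v assume "v \<in> common N"
    then have v: "v \<in> half_common N \<sigma>" for \<sigma> by (simp add: common_def half_common_def)
    note R = half_common_relations[OF assms(1,2) v]
    have "e i v \<in> component N m" for m
    proof -
      consider "i = 0" | "i = 1" | "i \<ge> 2" by linarith
      then show ?thesis
      proof cases
        case 1
        have "A m 0 (e 1 v) - scale (1 - b) (e 0 v) + (- A m 0 (e 1 v) - scale (1 - b) (e 0 v))
            \<in> component N m"
          using V.subspace_add[OF component_subspace R(3)[of m m] R(3)[of m "m + 1"]] by simp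
        moreover have "A m 0 (e 1 v) - scale (1 - b) (e 0 v) + (- A m 0 (e 1 v) - scale (1 - b) (e 0 v))
            = scale (- 2 * (1 - b)) (e 0 v)"
          using V.scale_left_distrib[of "- (1 - b)" "- (1 - b)" "e 0 v"]
          by (simp add: V.scale_left_diff_distrib algebra_simps)
        ultimately have "scale (- 2 * (1 - b)) (e 0 v) \<in> component N m" by simp
        then show ?thesis
          unfolding 1 by (rule V.subspace_scale_cancel[OF component_subspace]) (use assms(2) in simp)
      qed (use R(1)[of i m] R(2)[of m m] in simp_all)
    qed
    then show "e i v \<in> common N" by (simp add: common_def)
  qed
qed

text \<open>If no nonzero vector is common to all degrees, the relations kill \<open>e\<^sub>i w\<close> for \<open>i \<ge> 2\<close>, and
\<open>y = (e\<^sub>1 - (b - 1)) w\<close> satisfies \<open>e\<^sub>0 y \<in> half_common N \<sigma>\<close>. Hence \<open>0 = e\<^sub>2 e\<^sub>0 y = - 2 e\<^sub>1 y\<close>,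
so that \<open>y\<close> is killed by all \<open>e\<^sub>i\<close> with \<open>i \<ge> 1\<close> and vanishes.\<close>

lemma minus_one_submodule:
  assumes "lam = - 1" "b \<noteq> 1" "N \<noteq> {0}" "N \<noteq> UNIV"
  obtains \<sigma> w where "w \<noteq> 0" "w \<in> half_common N \<sigma>" "e 1 w = scale (b - 1) w"
    "\<And>i. i \<ge> 2 \<Longrightarrow> e i w = 0"
proof -
  obtain \<sigma> w where w: "w \<noteq> 0" "w \<in> half_common N \<sigma>" using ex_half_common[OF assms(1-3)] by blast
  note R = half_common_relations[OF assms(1,2)]
  have common_0: "v = 0" if "v \<in> common N" for v
    using minus_one_common_UNIV[OF assms(1,2) that] assms(4) by blast
  have e2: "e i v = 0" if "v \<in> half_common N \<sigma>" "i \<ge> 2" for v i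
    by (rule common_0) (simp add: common_def R(1)[OF that])
  define y where "y = e 1 w - scale (b - 1) w"
  have "e 0 y \<in> half_common N \<sigma>"
    unfolding half_common_def
  proof safe
    fix m assume m: "even (m - \<sigma>)"
    note N' = component_subspace[of m]
    have "(- 1 :: complex) powi (m - \<sigma>) = 1" using m by (simp add: power_int_minus_left)
    then have "A m 0 (e 1 w) - scale (1 - b) (e 0 w) \<in> component N m"
      using R(3)[OF w(2), of m] by simp
    from V.subspace_diff[OF N' V.subspace_scale[OF N' R(2)[OF w(2) m], of "a + of_int m"] this]
    show "e 0 y \<in> component N m"
      by (simp add: A_def y_def linear_diff[OF e_linear] linear_scale[OF e_linear]
          V.scale_left_diff_distrib linear_add[OF e_linear] algebra_simps)
  qed
  moreover have y2: "e i y = 0" if "i \<ge> 2" for i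
    using that e_commute[of i 1 w] e2[OF w(2), of i]
    by (simp add: y_def linear_diff[OF e_linear] linear_scale[OF e_linear] linear_zero[OF e_linear])
  ultimately have "e 2 (e 0 y) = 0" using e2 by blast
  then have "scale 2 (e 1 y) = 0"
    using e_e0[of 2 y] y2[of 2] by (simp add: linear_zero[OF e_linear])
  then have "e 1 y = 0" by simp
  then have "e i y = 0" if "i \<ge> 1" for i using y2[of i] that by (cases "i = 1") auto
  then have "y = 0" by (rule e_pos_kernel)
  then show ?thesis using that[OF w] e2[OF w(2)] by (simp add: y_def)
qed

end

section \<open>Reducibility for lam = 1 and for b = 1\<close>

lemma loop_simple_iff:
  "loop_simple scale act lam a b \<longleftrightarrow> (\<forall>N. loop_submodule N \<longrightarrow> N = {0} \<or> N = UNIV)"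
proof -
  obtain w :: 'w where "w \<noteq> 0" using ex_nonzero by blast
  then have "Poly_Mapping.single (0::int) w \<noteq> 0" by (metis lookup_single_eq lookup_zero)
  then have "UNIV \<noteq> {0 :: int \<Rightarrow>\<^sub>0 'w}" by blast
  then show ?thesis
    unfolding loop_simple_def simple_lie_module_def simple_lie_submodule_def
    using P.lie_module_axioms by (auto simp: lie_submodule_def)
qed

lemma not_simple_graded:
  assumes S: "\<And>j. V.subspace (S j)" "\<And>k j w. w \<in> S j \<Longrightarrow> C k j w \<in> S (k + j)"
    and "v \<in> S i" "v \<noteq> 0" "u \<notin> S j"
  shows "\<not> loop_simple scale act lam a b"
proof -
  let ?N = "{f. \<forall>j. Poly_Mapping.lookup f j \<in> S j}"
  have "Poly_Mapping.single i v \<in> ?N"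
    using assms(3) V.subspace_0[OF S(1)] by (simp add: lookup_single when_def)
  moreover have "Poly_Mapping.single i v \<noteq> 0"
    using assms(4) by (metis lookup_single_eq lookup_zero)
  ultimately have "?N \<noteq> {0}" by blast
  moreover have "Poly_Mapping.single j u \<notin> ?N"
  proof
    assume "Poly_Mapping.single j u \<in> ?N"
    then have "Poly_Mapping.lookup (Poly_Mapping.single j u) j \<in> S j" by blast
    then show False using assms(5) by simp
  qed
  then have "?N \<noteq> UNIV" by blast
  ultimately show ?thesis using graded_submodule[OF S] loop_simple_iff by blast
qed

text \<open>The space \<open>X\<close> killed by all \<open>e\<^sub>i\<close> with \<open>i \<ge> n\<close> is proper: if \<open>e\<^sub>n = 0\<close>, then
\<open>n e\<^sub>n\<^sub>-\<^sub>1 = [e\<^sub>0, e\<^sub>n] = 0\<close>, and descending shows that the action is trivial.\<close>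

lemma not_simple_lam_1:
  assumes "lam = 1"
  shows "\<not> loop_simple scale act lam a b"
proof -
  obtain w :: 'w where w: "w \<noteq> 0" using ex_nonzero by blast
  obtain n0 where n0: "\<And>i. i \<ge> n0 \<Longrightarrow> e i w = 0" using e_bound by blast
  \<comment> \<open>A positive \<open>n\<close> is needed to split off the term \<open>e 0 v\<close> of \<open>E k v\<close> below.\<close>
  define n where "n = Suc n0"
  define X where "X = {v. \<forall>i\<ge>n. e i v = 0}"
  have X: "V.subspace X"
    by (rule V.subspaceI)
      (auto simp: X_def linear_zero[OF e_linear] linear_add[OF e_linear] linear_scale[OF e_linear])
  have eX: "e i v \<in> X" if "v \<in> X" "i \<ge> 1" for i v
    using that e_commute[of _ i v] by (auto simp: X_def linear_zero[OF e_linear])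
  have "\<exists>u. u \<notin> X"
  proof (rule ccontr)
    assume "\<nexists>u. u \<notin> X"
    then have "e n v = 0" for v by (simp add: X_def)
    then have "e (n - d) v = 0" if "d \<le> n" for d v
      using that
    proof (induction d arbitrary: v)
      case (Suc d)
      have "e (n - d) (e 0 v) = e 0 (e (n - d) v) - scale (of_nat (n - d)) (e (n - d - 1) v)"
        by (rule e_e0)
      then have "scale (of_nat (n - d)) (e (n - d - 1) v) = 0"
        using Suc by (simp add: linear_zero[OF e_linear])
      then show ?case using Suc.prems by simp
    qed simp
    then have "e i v = 0" if "i \<le> n" for i v
      using that diff_diff_cancel[OF that] by (metis diff_le_self)
    moreover have "e i v = 0" if "i > n" for i v
      using that \<open>\<nexists>u. u \<notin> X\<close> by (simp add: X_def)
    ultimately have "e i v = 0" for i v by (cases "i \<le> n") auto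
    then show False using ex_e_nonzero by blast
  qed
  then obtain u where u: "u \<notin> X" by blast
  show ?thesis
  proof (rule not_simple_graded[of "\<lambda>_. X", OF X _ _ w u])
    show "w \<in> X" using n0 by (simp add: X_def n_def)
    fix k j v assume v: "v \<in> X"
    have "E k v = (\<Sum>i<Suc n0. scale (of_int k ^ i / fact i) (e i v))"
      by (rule E_eq) (use v in \<open>simp add: X_def n_def\<close>)
    also have "\<dots> = e 0 v + (\<Sum>i<n0. scale (of_int k ^ Suc i / fact (Suc i)) (e (Suc i) v))"
      by (subst sum.lessThan_Suc_shift) simp
    finally have "C k j v = (\<Sum>i<n0. scale (of_int k ^ Suc i / fact (Suc i)) (e (Suc i) v))
        + scale (a + of_int k * b + of_int j) v"
      unfolding C_eq unfolding assms by simp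
    also have "\<dots> \<in> X"
      by (intro V.subspace_add[OF X] V.subspace_sum[OF X] V.subspace_scale[OF X] eX v) simp
    finally show "C k j v \<in> X" .
  qed
qed

text \<open>For \<open>b = 1\<close> the relation \<open>E\<^sub>k (e\<^sub>0 - c) = (e\<^sub>0 - c - k) E\<^sub>k\<close> shows that the images of
\<open>e\<^sub>0 - a - j\<close> are compatible with the grading shift.\<close>

lemma not_simple_b_1:
  assumes "b = 1"
  shows "\<not> loop_simple scale act lam a b"
proof -
  let ?T = "\<lambda>j v. e 0 v - scale (a + of_int j) v"
  have T: "Vector_Spaces.linear scale scale (?T j)" for j :: int
    by (rule linearI[OF V.vector_space_axioms V.vector_space_axioms])
      (simp_all add: linear_add[OF e_linear] linear_scale[OF e_linear] V.scale_right_distrib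
        V.scale_right_diff_distrib mult.commute)
  obtain u where u: "\<And>c. u \<notin> range (\<lambda>v. e 0 v - scale c v)" using e0_not_surj by blast
  obtain w :: 'w where w: "w \<noteq> 0" using ex_nonzero by blast
  then obtain r where "top_index r w" using ex_top_index by blast
  then have "top_index (Suc r) (?T 0 w)" by (rule top_index_e0)
  then have T0: "?T 0 w \<noteq> 0" by (auto simp: top_index_def linear_zero[OF e_linear])
  show ?thesis
  proof (rule not_simple_graded[of "\<lambda>j. range (?T j)", OF _ _ rangeI T0 u])
    show "V.subspace (range (?T j))" for j
      by (rule V.subspaceI)
        (auto simp only: linear_add[OF T, symmetric] linear_scale[OF T, symmetric] image_iff
          intro: exI[of _ 0] linear_zero[OF T, symmetric])
    show "C k j v \<in> range (?T (k + j))" if "v \<in> range (?T j)" for k j v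
    proof -
      from that obtain x where v: "v = ?T j x" by blast
      have "C k j v = ?T (k + j) (scale (lam powi k) (E k x) - ?T j x)"
        unfolding v C_eq unfolding assms
        by (simp add: linear_diff[OF E_linear] linear_scale[OF E_linear] E_e0 linear_diff[OF e_linear]
            linear_scale[OF e_linear] linear_add[OF e_linear] linear_add[OF E_linear]
            V.scale_right_diff_distrib V.scale_left_distrib
            V.scale_left_diff_distrib V.scale_right_distrib algebra_simps)
      then show ?thesis by blast
    qed
  qed
qed

end

section \<open>Highest weight modules as polynomials\<close>

context simple_witt_O_module
begin

lemma highest_weight_iff:
  "witt_highest_weight scale act w b' \<longleftrightarrow>
     w \<noteq> 0 \<and> e 1 w = scale b' w \<and> (\<forall>i\<ge>2. e i w = 0)"
proof -
  have "(\<forall>i>0. act (witt_d i) w = 0) \<longleftrightarrow> (\<forall>i\<ge>2. e i w = 0)"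
  proof safe
    fix i :: nat assume "\<forall>i>0. act (witt_d i) w = 0" "i \<ge> 2"
    then show "e i w = 0" using act_witt_d[of i] by (metis diff_gt_0_iff_gt of_nat_1 of_nat_less_iff
          Suc_1 Suc_le_lessD)
  next
    fix i :: int assume *: "\<forall>i\<ge>2. e i w = 0" "i > 0"
    then show "act (witt_d i) w = 0" using act_witt_d[of "nat (i + 1)"] by simp
  qed
  moreover have "lie_submodule scale act hull {w} = UNIV" if "w \<noteq> 0"
    using submodule_UNIV[OF _ _ that] by (auto simp: hull_def)
  ultimately show ?thesis
    using act_witt_d[of 1] W.lie_module_axioms by (auto simp: witt_highest_weight_def)
qed

lemma e0_poly_1: "e0_poly w 1 = w"
  by (simp only: one_pCons e0_poly_pCons) (simp add: linear_zero[OF e_linear])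

context
  fixes w0 b' assumes hw: "witt_highest_weight scale act w0 b'"
begin

lemma w0: "w0 \<noteq> 0" "e 1 w0 = scale b' w0" "\<And>i. i \<ge> 2 \<Longrightarrow> e i w0 = 0"
  using hw by (simp_all add: highest_weight_iff)

lemma highest_weight_nonzero: "b' \<noteq> 0"
proof
  assume b': "b' = 0"
  have "e i w0 = 0" if "i \<ge> 1" for i
    using w0(2) w0(3)[of i] b' that by (cases "i = 1") auto
  then show False using e_pos_kernel w0(1) by blast
qed

lemma range_e0_poly: "range (e0_poly w0) = UNIV"
proof (rule submodule_UNIV[OF _ _ w0(1)])
  show "lie_submodule scale act (range (e0_poly w0))"
    by (rule e0_poly_submodule) (use w0 in auto)
qed (rule range_eqI[of _ _ 1], simp add: e0_poly_1)

lemma top_index_e0_poly: "p \<noteq> 0 \<Longrightarrow> top_index (Suc (degree p)) (e0_poly w0 p)"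
proof (induction p)
  case (pCons c p)
  show ?case
  proof (cases "p = 0")
    case True
    then show ?thesis
      using pCons.hyps w0 highest_weight_nonzero
      by (auto simp: top_index_def linear_zero[OF e_linear] linear_scale[OF e_linear])
  next
    case False
    from top_index_e0[OF pCons.IH[OF False], of 0] False show ?thesis
      by (auto simp: top_index_def linear_add[OF e_linear] linear_scale[OF e_linear] w0)
  qed
qed simp

lemma e0_poly_eq_0_iff: "e0_poly w0 p = 0 \<longleftrightarrow> p = 0"
proof (cases "p = 0")
  case False
  then show ?thesis
    using top_index_e0_poly[of p] linear_zero[OF e_linear] by (auto simp: top_index_def)
qed simp

lemma e0_poly_inj: "e0_poly w0 p = e0_poly w0 q \<longleftrightarrow> p = q"
  using e0_poly_eq_0_iff[of "p - q"] by (simp add: linear_diff[OF e0_poly_linear])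

text \<open>The top index of \<open>p(e\<^sub>0) w\<^sub>0\<close> is \<open>degree p + 1\<close>, and a highest weight vector has top index at
most \<open>1\<close>.\<close>

lemma highest_weight_unique:
  assumes "witt_highest_weight scale act w b''"
  shows "b'' = b'" and "\<exists>c. c \<noteq> 0 \<and> w = scale c w0"
proof -
  have w: "w \<noteq> 0" "e 1 w = scale b'' w" "\<And>i. i \<ge> 2 \<Longrightarrow> e i w = 0"
    using assms by (simp_all add: highest_weight_iff)
  obtain p where p: "w = e0_poly w0 p" using range_e0_poly by (metis UNIV_I imageE)
  then have "p \<noteq> 0" using w(1) by auto
  then have "\<not> Suc (degree p) \<ge> 2"
    using top_index_e0_poly[of p] w(3) by (auto simp: top_index_def p)
  then have "degree p = 0" by simp
  then obtain c where c: "p = [:c:]" by (rule degree_eq_zeroE)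
  then have wc: "w = scale c w0" using p by (simp add: linear_zero[OF e_linear])
  show "\<exists>c. c \<noteq> 0 \<and> w = scale c w0" using wc w(1) by auto
  have "scale (c * b') w0 = scale (c * b'') w0"
    using w(2) w0(2) by (simp add: wc linear_scale[OF e_linear] mult.commute)
  then show "b'' = b'" using w(1) w0(1) wc by simp
qed

end

end

section \<open>The reflection and its two eigenspaces\<close>

locale highest_weight_loop = simple_witt_O_module scale act
  for scale :: "complex \<Rightarrow> 'w::ab_group_add \<Rightarrow> 'w" and act :: "complex poly \<Rightarrow> 'w \<Rightarrow> 'w" +
  fixes w0 :: 'w and b' a :: complex
  assumes hw: "witt_highest_weight scale act w0 b'"
begin

sublocale loop_module scale act "- 1" a "b' + 1"
  by unfold_locales simp

abbreviation \<phi> :: "complex poly \<Rightarrow> 'w" where "\<phi> \<equiv> e0_poly w0"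

lemmas \<phi>_linear = e0_poly_linear[of w0]
lemma \<phi>_E: "E k (\<phi> p) = \<phi> ([:of_int k * b', 1:] * pcompose p [:- of_int k, 1:])"
  by (rule e0_poly_E) (use w0(2,3)[OF hw] in auto)

lemmas \<phi>_inj = e0_poly_inj[OF hw]

lemma b: "b' + 1 \<noteq> 1"
  using highest_weight_nonzero[OF hw] by simp

lemmas \<phi>_1 = e0_poly_1[of w0]

lemma C_\<phi>:
  "C k j (\<phi> p) = \<phi> (smult ((- 1) powi k) ([:of_int k * b', 1:] * pcompose p [:- of_int k, 1:])
    + [:a + of_int k * (b' + 1) + of_int j, - 1:] * p)"
proof -
  have "[:a + of_int k * (b' + 1) + of_int j, - 1:] * p =
      smult (a + of_int k * (b' + 1) + of_int j) p - pCons 0 p"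
    by simp
  then show ?thesis
    unfolding C_eq \<phi>_E
    by (simp only: linear_add[OF \<phi>_linear] linear_diff[OF \<phi>_linear] linear_scale[OF \<phi>_linear]
        e0_poly_pCons V.scale_zero_left add_0_left) (simp only: algebra_simps)
qed

text \<open>The substitution \<open>x \<mapsto> a + j - x\<close> in degree \<open>j\<close>. Up to the sign \<open>(-1)\<^sup>j\<close> it commutes with the
Virasoro action for \<open>lam = -1\<close> and \<open>b = b' + 1\<close>, by exchanging the two summands of \<open>C_\<phi>\<close>.\<close>

definition reflect :: "int \<Rightarrow> complex poly \<Rightarrow> complex poly" where
  "reflect j p = pcompose p [:a + of_int j, - 1:]"

lemma reflect_simps:
  "reflect j (p + q) = reflect j p + reflect j q" "reflect j (p - q) = reflect j p - reflect j q"
  "reflect j (smult c p) = smult c (reflect j p)" "reflect j (p * q) = reflect j p * reflect j q"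
  "reflect j 0 = 0" "reflect j [:c, d:] = [:c + d * (a + of_int j), - d:]" "reflect j 1 = 1"
  by (simp_all add: reflect_def pcompose_add pcompose_diff pcompose_smult pcompose_mult
      pcompose_pCons pcompose_1)

lemma reflect_reflect: "reflect j (reflect j p) = p"
  by (simp add: reflect_def pcompose_assoc[symmetric] pcompose_pCons)

definition parity_sign :: "int \<Rightarrow> int \<Rightarrow> complex" where
  "parity_sign \<sigma> j = (- 1) powi (j + \<sigma>)"

lemma parity_sign_square: "parity_sign \<sigma> j * parity_sign \<sigma> j = 1"
  by (simp add: parity_sign_def power_int_minus_left)

definition eigenspace :: "int \<Rightarrow> int \<Rightarrow> 'w set" where
  "eigenspace \<sigma> j = {\<phi> p | p. reflect j p = smult (parity_sign \<sigma> j) p}"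

lemma \<phi>_eigenspace_iff: "\<phi> p \<in> eigenspace \<sigma> j \<longleftrightarrow> reflect j p = smult (parity_sign \<sigma> j) p"
  by (auto simp: eigenspace_def \<phi>_inj)

lemma w0_eigenspace_iff: "w0 \<in> eigenspace \<sigma> j \<longleftrightarrow> even (j + \<sigma>)"
proof -
  have "w0 \<in> eigenspace \<sigma> j \<longleftrightarrow> 1 = smult (parity_sign \<sigma> j) 1"
    using \<phi>_eigenspace_iff[of 1 \<sigma> j] by (simp only: \<phi>_1 reflect_simps)
  also have "\<dots> \<longleftrightarrow> parity_sign \<sigma> j = 1"
    by (simp only: one_pCons smult_pCons smult_0_right pCons_eq_iff mult_1_right simp_thms eq_commute)
  finally show ?thesis by (simp add: parity_sign_def power_int_minus_left)
qed

lemma subspace_eigenspace: "V.subspace (eigenspace \<sigma> j)"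
proof (rule V.subspaceI)
  show "0 \<in> eigenspace \<sigma> j" using \<phi>_eigenspace_iff[of 0 \<sigma> j] by (simp add: reflect_simps)
  show "x + y \<in> eigenspace \<sigma> j" if "x \<in> eigenspace \<sigma> j" "y \<in> eigenspace \<sigma> j" for x y
    using that by (auto simp: eigenspace_def reflect_simps smult_add_right
        simp flip: linear_add[OF \<phi>_linear])
  show "scale c x \<in> eigenspace \<sigma> j" if "x \<in> eigenspace \<sigma> j" for c x
    using that by (auto simp: eigenspace_def reflect_simps mult.commute
        simp flip: linear_scale[OF \<phi>_linear])
qed

text \<open>The eigenspace of the involution \<open>p(x) t\<^sup>j \<mapsto> (-1)\<^sup>j p(a + j - x) t\<^sup>j\<close> for the eigenvalue
\<open>(-1)\<^sup>\<sigma>\<close>.\<close>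

definition half :: "int \<Rightarrow> (int \<Rightarrow>\<^sub>0 'w) set" where
  "half \<sigma> = {f. \<forall>j. Poly_Mapping.lookup f j \<in> eigenspace \<sigma> j}"

lemma single_half_iff: "Poly_Mapping.single j w \<in> half \<sigma> \<longleftrightarrow> w \<in> eigenspace \<sigma> j"
  using V.subspace_0[OF subspace_eigenspace]
  by (auto simp: half_def lookup_single when_def split: if_splits)

lemma half_submodule: "loop_submodule (half \<sigma>)"
  unfolding half_def
proof (rule graded_submodule[OF subspace_eigenspace])
  fix k j w assume "w \<in> eigenspace \<sigma> j"
  then obtain p where w: "w = \<phi> p" and p: "reflect j p = smult (parity_sign \<sigma> j) p"
    by (auto simp: eigenspace_def)
  define t :: complex where "t = (- 1) powi k"
  define p' where "p' = pcompose p [:- of_int k, 1:]"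
  have tt: "t * t = 1" by (simp add: t_def power_int_minus_left)
  have t: "parity_sign \<sigma> (k + j) = t * parity_sign \<sigma> j"
    by (simp add: parity_sign_def t_def power_int_minus_left)
  have 1: "reflect (k + j) p' = smult (parity_sign \<sigma> j) p"
    using p by (simp add: p'_def reflect_def pcompose_assoc[symmetric] pcompose_pCons algebra_simps)
  have 2: "reflect (k + j) p = smult (parity_sign \<sigma> j) p'"
    unfolding p'_def pcompose_smult[symmetric] p[symmetric]
    by (simp add: reflect_def pcompose_assoc[symmetric] pcompose_pCons algebra_simps)
  let ?r = "smult t ([:of_int k * b', 1:] * p') + [:a + of_int k * (b' + 1) + of_int j, - 1:] * p"
  have "reflect (k + j) ?r = smult t ([:a + of_int k * (b' + 1) + of_int j, - 1:] * smult (parity_sign \<sigma> j) p)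
      + [:of_int k * b', 1:] * smult (parity_sign \<sigma> j) p'"
    unfolding reflect_simps 1 2 by (simp add: algebra_simps)
  also have "\<dots> = smult (parity_sign \<sigma> (k + j)) ?r"
    unfolding t smult_add_right mult_smult_right mult_smult_left smult_smult
    using tt by (simp add: mult.commute mult.left_commute add.commute)
  finally show "C k j w \<in> eigenspace \<sigma> (k + j)"
    unfolding w C_\<phi> \<phi>_eigenspace_iff p'_def t_def .
qed

text \<open>Both summands of \<open>C_\<phi>\<close> for \<open>k = 1\<close> have leading coefficient \<open>-1\<close> times that of the argument, so
\<open>d\<^sub>1\<close> raises the degree by one and multiplies the leading coefficient by \<open>-2\<close>.\<close>

lemma generator_degree:
  "\<exists>q. (L (vir_d 1) ^^ i) (Poly_Mapping.single j w0) = Poly_Mapping.single (j + int i) (\<phi> q)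
    \<and> degree q = i \<and> q \<noteq> 0"
proof (induction i)
  case 0
  show ?case by (rule exI[of _ 1]) (simp add: \<phi>_1)
next
  case (Suc i)
  then obtain q where q: "(L (vir_d 1) ^^ i) (Poly_Mapping.single j w0) = Poly_Mapping.single (j + int i) (\<phi> q)"
    "degree q = i" "q \<noteq> 0" by blast
  define q1 where "q1 = pcompose q [:- 1, 1:]"
  have q1: "degree q1 = i" "coeff q1 i = coeff q i"
    using lead_coeff_comp[of "[:- 1, 1:]" q] q(2) by (simp_all add: q1_def degree_pcompose)
  define r where "r = smult (- 1) ([:b', 1:] * q1) + [:a + (b' + 1) + of_int (j + int i), - 1:] * q"
  have "coeff r (Suc i) = - 2 * coeff q i"
    using coeff_eq_0[of q "Suc i"] coeff_eq_0[of q1 "Suc i"] q q1 by (simp add: r_def)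
  moreover have "coeff q i \<noteq> 0" using q by auto
  ultimately have "coeff r (Suc i) \<noteq> 0" by simp
  moreover have "coeff r n = 0" if "n > Suc i" for n
    using that q q1 by (cases n) (simp_all add: r_def coeff_eq_0)
  ultimately have "degree r = Suc i" "r \<noteq> 0"
    by (metis le_antisym le_degree degree_le, metis coeff_0)
  moreover have "(L (vir_d 1) ^^ Suc i) (Poly_Mapping.single j w0) = Poly_Mapping.single (j + int (Suc i)) (\<phi> r)"
  proof -
    have "C 1 (j + int i) (\<phi> q) = \<phi> r"
      using C_\<phi>[of 1 "j + int i" q] by (simp only: r_def q1_def) (simp add: add.assoc)
    then show ?thesis using q(1) by (simp add: L_d add.assoc add.left_commute[of 1])
  qed
  ultimately show ?case by blast
qed

abbreviation L_half :: "int \<Rightarrow> (int \<Rightarrow>\<^sub>0 'w) set" where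
  "L_half \<sigma> \<equiv> loop_half scale act w0 \<sigma> a b'"

lemma generator_mem_loop_half:
  assumes "even (j + \<sigma>)"
  shows "(L (vir_d 1) ^^ i) (Poly_Mapping.single j w0) \<in> L_half \<sigma>"
proof -
  have "j = 2 * ((j - \<sigma>) div 2) + \<sigma>" using assms by presburger
  then show ?thesis
    unfolding loop_half_def
    by (intro Q.span_base CollectI exI[of _ i] exI[of _ "(j - \<sigma>) div 2"]) simp
qed

lemma loop_half_subset:
  assumes "loop_submodule N" "\<And>j. even (j + \<sigma>) \<Longrightarrow> Poly_Mapping.single j w0 \<in> N"
  shows "L_half \<sigma> \<subseteq> N"
proof -
  have "(L (vir_d 1) ^^ i) (Poly_Mapping.single (2 * j + \<sigma>) w0) \<in> N" for i j
    using assms by (induction i) (simp_all add: lie_submodule_def)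
  then show ?thesis
    unfolding loop_half_def
    by (intro Q.span_minimal submodule_subspace[OF assms(1)]) blast
qed

text \<open>Reflection multiplies the leading coefficient of a polynomial of degree \<open>n\<close> by \<open>(-1)\<^sup>n\<close>, so in
an eigenspace the degree has a fixed parity. Exactly in these degrees \<open>generator_degree\<close>
supplies an element of \<open>loop_half\<close>, whose multiple can be subtracted to lower the degree.\<close>

lemma eigenspace_mem_loop_half:
  assumes "reflect j p = smult (parity_sign \<sigma> j) p"
  shows "Poly_Mapping.single j (\<phi> p) \<in> L_half \<sigma>"
  using assms
proof (induction "degree p" arbitrary: p rule: less_induct)
  case less
  note S = Q.subspace_span[of "{(L (vir_d 1) ^^ i) (Poly_Mapping.single (2 * j + \<sigma>) w0) | i j. True}",
      folded loop_half_def]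
  show ?case
  proof (cases "p = 0")
    case True
    then show ?thesis using Q.subspace_0[OF S] by simp
  next
    case False
    define n where "n = degree p"
    have "lead_coeff (reflect j p) = lead_coeff p * (- 1) ^ n"
      by (simp add: reflect_def lead_coeff_comp n_def)
    then have "parity_sign \<sigma> j * lead_coeff p = lead_coeff p * (- 1) ^ n"
      unfolding less.prems lead_coeff_smult .
    then have "(- 1) ^ n = parity_sign \<sigma> j"
      using False by (simp add: mult.commute)
    then have ev: "even (j - int n + \<sigma>)"
      by (auto simp: parity_sign_def power_int_minus_left uminus_power_if split: if_splits)
    obtain q where q: "(L (vir_d 1) ^^ n) (Poly_Mapping.single (j - int n) w0) = Poly_Mapping.single j (\<phi> q)"
      "degree q = n" "q \<noteq> 0"
      using generator_degree[of n "j - int n"] by auto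
    have gen: "Poly_Mapping.single j (\<phi> q) \<in> L_half \<sigma>"
      using generator_mem_loop_half[OF ev, of n] by (simp add: q)
    moreover have "L_half \<sigma> \<subseteq> half \<sigma>"
      by (rule loop_half_subset[OF half_submodule]) (simp add: single_half_iff w0_eigenspace_iff)
    ultimately have sq: "reflect j q = smult (parity_sign \<sigma> j) q"
      using single_half_iff \<phi>_eigenspace_iff by blast
    define c where "c = lead_coeff p / lead_coeff q"
    define p' where "p' = p - smult c q"
    have sp': "reflect j p' = smult (parity_sign \<sigma> j) p'"
      by (simp add: p'_def reflect_simps less.prems sq smult_diff_right)
    have "Poly_Mapping.single j (\<phi> p') \<in> L_half \<sigma>"
    proof (cases "p' = 0")
      case True
      then show ?thesis using Q.subspace_0[OF S] by simp
    next
      case False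
      have "degree p' \<le> n" using q by (simp add: p'_def n_def degree_diff_le)
      moreover have "coeff p' n = 0"
        using q leading_coeff_neq_0[OF q(3)] by (simp add: p'_def c_def n_def)
      ultimately have "degree p' < n" using False by (metis le_neq_implies_less leading_coeff_0_iff)
      then show ?thesis using less.hyps sp' by (simp add: n_def)
    qed
    then have "Poly_Mapping.single j (\<phi> p') + pm_scale scale c (Poly_Mapping.single j (\<phi> q)) \<in> L_half \<sigma>"
      by (intro Q.subspace_add[OF S] Q.subspace_scale[OF S] gen)
    moreover have "Poly_Mapping.single j (\<phi> p') + pm_scale scale c (Poly_Mapping.single j (\<phi> q))
        = Poly_Mapping.single j (\<phi> p)"
      by (simp add: scale_single single_add[symmetric] linear_scale[OF \<phi>_linear, symmetric]
          linear_add[OF \<phi>_linear, symmetric] p'_def)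
    ultimately show ?thesis by simp
  qed
qed

lemma loop_half_eq_half: "L_half \<sigma> = half \<sigma>"
proof
  show "L_half \<sigma> \<subseteq> half \<sigma>"
    by (rule loop_half_subset[OF half_submodule]) (simp add: single_half_iff w0_eigenspace_iff)
  show "half \<sigma> \<subseteq> L_half \<sigma>"
  proof
    fix f assume f: "f \<in> half \<sigma>"
    have "Poly_Mapping.single j (Poly_Mapping.lookup f j) \<in> L_half \<sigma>" for j
    proof -
      from f obtain p where "Poly_Mapping.lookup f j = \<phi> p" "reflect j p = smult (parity_sign \<sigma> j) p"
        by (auto simp: half_def eigenspace_def)
      then show ?thesis by (simp add: eigenspace_mem_loop_half)
    qed
    then have "(\<Sum>j\<in>Poly_Mapping.keys f. Poly_Mapping.single j (Poly_Mapping.lookup f j)) \<in> L_half \<sigma>"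
      unfolding loop_half_def by (intro Q.span_sum) auto
    then show "f \<in> L_half \<sigma>" by (simp add: sum_single)
  qed
qed

lemma half_parity: "even (\<sigma> - \<tau>) \<Longrightarrow> half \<sigma> = half \<tau>"
proof -
  assume "even (\<sigma> - \<tau>)"
  then have "parity_sign \<sigma> j = parity_sign \<tau> j" for j by (simp add: parity_sign_def power_int_minus_left)
  then show ?thesis by (simp add: half_def eigenspace_def)
qed

lemma proper_submodule_contains_w0:
  assumes N: "loop_submodule N" "N \<noteq> {0}" "N \<noteq> UNIV"
  obtains \<sigma> where "\<And>j. even (j + \<sigma>) \<Longrightarrow> Poly_Mapping.single j w0 \<in> N"
proof -
  obtain \<sigma> w where w: "w \<noteq> 0" "w \<in> half_common N \<sigma>" "e 1 w = scale (b' + 1 - 1) w"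
    "\<And>i. i \<ge> 2 \<Longrightarrow> e i w = 0"
    using minus_one_submodule[OF N(1) refl b N(2,3)] by blast
  then have "witt_highest_weight scale act w b'" by (simp add: highest_weight_iff)
  then obtain c where c: "c \<noteq> 0" "w = scale c w0" using highest_weight_unique(2)[OF hw] by blast
  show ?thesis
  proof
    fix j assume "even (j + \<sigma>)"
    then have "even (j - \<sigma>)" by simp
    then have "scale c w0 \<in> component N j" using w(2) c(2) by (simp add: half_common_def)
    then show "Poly_Mapping.single j w0 \<in> N"
      using V.subspace_scale_cancel[OF component_subspace[OF N(1)] _ c(1)] by (simp add: component_def)
  qed
qed

text \<open>If \<open>N\<close> contains \<open>half \<sigma>\<close> properly, subtracting from a homogeneous component outside \<open>half \<sigma>\<close> its
projection to that eigenspace gives a nonzero element of \<open>N \<inter> half (\<sigma> + 1)\<close>. This intersection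
is itself a proper nonzero submodule, so it contains \<open>w0\<close> in all degrees of the other parity,
and \<open>w0\<close> becomes common to all degrees.\<close>

lemma proper_submodule_half:
  assumes N: "loop_submodule N" "N \<noteq> {0}" "N \<noteq> UNIV"
  shows "\<exists>\<sigma>. N = half \<sigma>"
proof -
  obtain \<sigma> where \<sigma>: "\<And>j. even (j + \<sigma>) \<Longrightarrow> Poly_Mapping.single j w0 \<in> N"
    using proper_submodule_contains_w0[OF N] by blast
  have sub: "half \<sigma> \<subseteq> N" using loop_half_subset[OF N(1) \<sigma>] by (simp add: loop_half_eq_half)
  have "N \<subseteq> half \<sigma>"
  proof (rule ccontr)
    assume "\<not> N \<subseteq> half \<sigma>"
    then obtain f j where f: "f \<in> N" "Poly_Mapping.lookup f j \<notin> eigenspace \<sigma> j"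
      by (auto simp: half_def)
    obtain p where p: "Poly_Mapping.lookup f j = \<phi> p"
      using range_e0_poly[OF hw] by (metis UNIV_I imageE)
    let ?s = "parity_sign \<sigma> j"
    define p0 p1 where "p0 = p + smult ?s (reflect j p)" and "p1 = p - smult ?s (reflect j p)"
    have s: "parity_sign (\<sigma> + 1) j = - ?s" by (simp add: parity_sign_def power_int_minus_left)
    have "reflect j p0 = smult ?s p0" "reflect j p1 = smult (parity_sign (\<sigma> + 1) j) p1"
      by (simp_all add: p0_def p1_def reflect_simps reflect_reflect s smult_add_right smult_diff_right
          parity_sign_square)
    then have p01: "\<phi> p0 \<in> eigenspace \<sigma> j" "\<phi> p1 \<in> eigenspace (\<sigma> + 1) j"
      by (simp_all add: \<phi>_eigenspace_iff)
    have "p1 \<noteq> 0"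
    proof
      assume "p1 = 0"
      then have "smult ?s p = reflect j p"
        by (metis p1_def right_minus_eq smult_smult parity_sign_square smult_1_left)
      then show False using f(2) by (simp add: p \<phi>_eigenspace_iff)
    qed
    then have "\<phi> p1 \<noteq> 0" using e0_poly_eq_0_iff[OF hw] by simp
    note N' = component_subspace[OF N(1), of j]
    have "\<phi> p \<in> component N j" using lookup_mem_component[OF N(1) f(1), of j] p by simp
    moreover have "\<phi> p0 \<in> component N j"
      using sub p01(1) by (auto simp: component_def single_half_iff)
    ultimately have "\<phi> p + \<phi> p - \<phi> p0 \<in> component N j"
      by (intro V.subspace_diff[OF N'] V.subspace_add[OF N'])
    also have "\<phi> p + \<phi> p - \<phi> p0 = \<phi> p1"
      by (simp add: p0_def p1_def linear_add[OF \<phi>_linear] linear_diff[OF \<phi>_linear])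
    finally have "Poly_Mapping.single j (\<phi> p1) \<in> N \<inter> half (\<sigma> + 1)"
      using p01(2) by (simp add: component_def single_half_iff)
    moreover have "Poly_Mapping.single j (\<phi> p1) \<noteq> 0"
      using \<open>\<phi> p1 \<noteq> 0\<close> by (metis lookup_single_eq lookup_zero)
    ultimately have "N \<inter> half (\<sigma> + 1) \<noteq> {0}" by blast
    moreover have "loop_submodule (N \<inter> half (\<sigma> + 1))"
      using N(1) half_submodule[of "\<sigma> + 1"] by (simp add: lie_submodule_def Q.subspace_inter)
    moreover have "N \<inter> half (\<sigma> + 1) \<noteq> UNIV" using N(3) by blast
    ultimately obtain \<tau> where \<tau>: "\<And>j. even (j + \<tau>) \<Longrightarrow> Poly_Mapping.single j w0 \<in> N \<inter> half (\<sigma> + 1)"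
      using proper_submodule_contains_w0 by blast
    from \<tau>[of \<tau>] have par: "even (\<tau> + (\<sigma> + 1))"
      by (auto simp: single_half_iff w0_eigenspace_iff)
    have "Poly_Mapping.single i w0 \<in> N" for i
    proof (cases "even (i + \<sigma>)")
      case False
      then have "even (i + \<tau>)" using par by presburger
      then show ?thesis using \<tau> by blast
    qed (rule \<sigma>)
    then have "w0 \<in> common N" by (simp add: common_def component_def)
    then show False
      using minus_one_common_UNIV[OF N(1) refl b _ w0(1)[OF hw]] N(3) by blast
  qed
  with sub show ?thesis by blast
qed

lemma half_nontrivial: "half \<sigma> \<noteq> {0}" "half \<sigma> \<noteq> UNIV" "half \<sigma> = half \<tau> \<longleftrightarrow> even (\<sigma> + \<tau>)"
proof -
  have mem: "Poly_Mapping.single j w0 \<in> half \<sigma> \<longleftrightarrow> even (j + \<sigma>)" for j \<sigma>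
    by (simp add: single_half_iff w0_eigenspace_iff)
  have "Poly_Mapping.single j w0 \<noteq> 0" for j :: int
    using w0(1)[OF hw] by (metis lookup_single_eq lookup_zero)
  then show "half \<sigma> \<noteq> {0}" using mem[of "- \<sigma>" \<sigma>] by auto
  have "Poly_Mapping.single (1 - \<sigma>) w0 \<notin> half \<sigma>" by (simp add: mem)
  then show "half \<sigma> \<noteq> UNIV" by blast
  show "half \<sigma> = half \<tau> \<longleftrightarrow> even (\<sigma> + \<tau>)"
    using mem[of \<tau> \<sigma>] mem[of \<tau> \<tau>] half_parity[of \<sigma> \<tau>] by auto
qed

lemma proper_submodules:
  "{N. loop_submodule N \<and> N \<noteq> {0} \<and> N \<noteq> UNIV} = {L_half 0, L_half 1}"
proof -
  have "half \<sigma> \<in> {half 0, half 1}" for \<sigma>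
    using half_nontrivial(3)[of \<sigma> 0] half_nontrivial(3)[of \<sigma> 1] by auto
  then have "N \<in> {half 0, half 1}" if "loop_submodule N" "N \<noteq> {0}" "N \<noteq> UNIV" for N
    using proper_submodule_half[OF that] by blast
  then show ?thesis
    unfolding loop_half_eq_half by (auto simp: half_submodule half_nontrivial(1,2))
qed

lemma loop_half_distinct: "L_half 0 \<noteq> L_half 1"
  unfolding loop_half_eq_half half_nontrivial(3) by simp

lemma loop_half_simple: "simple_lie_submodule (pm_scale scale) L (L_half \<sigma>)"
  unfolding simple_lie_submodule_def loop_half_eq_half
proof (intro conjI allI impI; (elim conjE)?)
  fix M assume M: "loop_submodule M" "M \<subseteq> half \<sigma>"
  show "M = {0} \<or> M = half \<sigma>"
  proof (cases "M = {0}")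
    case False
    moreover have "M \<noteq> UNIV" using M(2) half_nontrivial(2)[of \<sigma>] by blast
    ultimately obtain \<tau> where \<tau>: "M = half \<tau>" using proper_submodule_half[OF M(1)] by blast
    have "Poly_Mapping.single \<tau> w0 \<in> half \<tau>" by (simp add: single_half_iff w0_eigenspace_iff)
    then have "Poly_Mapping.single \<tau> w0 \<in> half \<sigma>" using M(2) \<tau> by blast
    then have "even (\<tau> + \<sigma>)" by (simp add: single_half_iff w0_eigenspace_iff)
    then show ?thesis using \<tau> half_nontrivial(3)[of \<tau> \<sigma>] by simp
  qed simp
qed (rule half_submodule half_nontrivial(1))+

lemma not_simple: "\<not> loop_simple scale act (- 1) a (b' + 1)"
  unfolding loop_simple_iff using half_submodule half_nontrivial(1,2) by blast

end

theorem theorem11: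
  fixes scale :: "complex \<Rightarrow> 'w::ab_group_add \<Rightarrow> 'w"
    and act :: "complex poly \<Rightarrow> 'w \<Rightarrow> 'w"
    and lam a b :: complex
  assumes "lam \<noteq> 0"
    and "in_O_witt scale act"
    and "simple_witt_module scale act"
    and "\<not> trivial_lie_module act"
  shows "(\<forall>b'. (\<exists>w0. witt_highest_weight scale act w0 b') \<longrightarrow>
            (loop_simple scale act lam a b \<longleftrightarrow>
              (lam \<noteq> 1 \<and> lam \<noteq> -1 \<and> b \<noteq> 1) \<or> (lam = -1 \<and> b \<noteq> 1 \<and> b \<noteq> b' + 1))) \<and>
         ((\<nexists>w0 b'. witt_highest_weight scale act w0 b') \<longrightarrow>
            (loop_simple scale act lam a b \<longleftrightarrow> lam \<noteq> 1 \<and> b \<noteq> 1)) \<and>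
         (\<forall>w0 b'. witt_highest_weight scale act w0 b' \<and> b' \<noteq> 0 \<longrightarrow>
            {N. lie_submodule (pm_scale scale) (loop_act scale act (-1) a (b' + 1)) N \<and>
                N \<noteq> {0} \<and> N \<noteq> UNIV}
              = {loop_half scale act w0 0 a b', loop_half scale act w0 1 a b'} \<and>
            loop_half scale act w0 0 a b' \<noteq> loop_half scale act w0 1 a b' \<and>
            simple_lie_submodule (pm_scale scale) (loop_act scale act (-1) a (b' + 1))
              (loop_half scale act w0 0 a b') \<and>
            simple_lie_submodule (pm_scale scale) (loop_act scale act (-1) a (b' + 1))
              (loop_half scale act w0 1 a b'))"
proof -
  interpret simple_witt_O_module scale act by unfold_locales (use assms in auto)
  interpret loop_module scale act lam a b by unfold_locales (rule assms)
  have hwl: "highest_weight_loop scale act w0 b'" if "witt_highest_weight scale act w0 b'" for w0 b'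
    by unfold_locales (rule that)
  have not_simple: "\<not> loop_simple scale act lam a b" if "lam = 1 \<or> b = 1"
    using that not_simple_lam_1 not_simple_b_1 by blast
  have simple: "loop_simple scale act lam a b" if "lam \<noteq> 1" "lam \<noteq> - 1" "b \<noteq> 1"
    using generic_submodule_UNIV that unfolding loop_simple_iff by blast
  have minus_one: "loop_simple scale act lam a b \<longleftrightarrow> (\<nexists>w. witt_highest_weight scale act w (b - 1))"
    if "lam = - 1" "b \<noteq> 1"
  proof
    assume S: "loop_simple scale act lam a b"
    show "\<nexists>w. witt_highest_weight scale act w (b - 1)"
    proof
      assume "\<exists>w. witt_highest_weight scale act w (b - 1)"
      then obtain w where "witt_highest_weight scale act w (b - 1)" by blast
      from highest_weight_loop.not_simple[OF hwl[OF this], of a] S that show False by simp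
    qed
  next
    assume "\<nexists>w. witt_highest_weight scale act w (b - 1)"
    then show "loop_simple scale act lam a b"
      unfolding loop_simple_iff highest_weight_iff using minus_one_submodule[OF _ that] by metis
  qed
  show ?thesis
  proof (intro conjI allI impI; (elim conjE exE)?)
    fix w0 b' assume hw: "witt_highest_weight scale act w0 b'"
    have "(\<exists>w. witt_highest_weight scale act w (b - 1)) \<longleftrightarrow> b = b' + 1"
      using hw highest_weight_unique(1)[OF hw] by (metis add_diff_cancel_right' diff_add_cancel)
    then show "loop_simple scale act lam a b \<longleftrightarrow>
        (lam \<noteq> 1 \<and> lam \<noteq> -1 \<and> b \<noteq> 1) \<or> (lam = -1 \<and> b \<noteq> 1 \<and> b \<noteq> b' + 1)"
      using not_simple simple minus_one by blast
  next
    assume "\<nexists>w0 b'. witt_highest_weight scale act w0 b'"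
    then show "loop_simple scale act lam a b \<longleftrightarrow> lam \<noteq> 1 \<and> b \<noteq> 1"
      using not_simple simple minus_one by blast
  next
    fix w0 b' assume hw: "witt_highest_weight scale act w0 b'"
    interpret H: highest_weight_loop scale act w0 b' a by (rule hwl[OF hw])
    show "{N. lie_submodule (pm_scale scale) (loop_act scale act (-1) a (b' + 1)) N \<and>
          N \<noteq> {0} \<and> N \<noteq> UNIV} = {loop_half scale act w0 0 a b', loop_half scale act w0 1 a b'}"
      by (rule H.proper_submodules)
    show "loop_half scale act w0 0 a b' \<noteq> loop_half scale act w0 1 a b'"
      by (rule H.loop_half_distinct)
    show "simple_lie_submodule (pm_scale scale) (loop_act scale act (-1) a (b' + 1))
        (loop_half scale act w0 0 a b')"
      "simple_lie_submodule (pm_scale scale) (loop_act scale act (-1) a (b' + 1))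
        (loop_half scale act w0 1 a b')"
      by (rule H.loop_half_simple)+
  qed
qed

end
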